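(* Let $\mathcal{A}$ be an abelian category. (1) Every self-CS-Rickart object of $\mathcal{A}$ has SIP-extending. (2) Every dual self-CS-Rickart object of $\mathcal{A}$ has SSP-lifting.
   Context: A subobject $K$ of $L$ is essential in $L$ if $K\cap X=0$ implies $X=0$ for every subobject $X$ of $L$; $K$ is superfluous in $L$ if $K+X=L$ implies $X=L$ for every subobject $X$ of $L$. A subobject $L$ of $M$ lies above a direct summand of $M$ if $L$ contains a direct summand $K$ of $M$ such that $L/K$ is superfluous in $M/K$. An object $M$ of an abelian category is self-CS-Rickart if for every morphism $f:M\to M$, $\mathrm{Ker}(f)$ is essential in a direct summand of $M$; $M$ is dual self-CS-Rickart if for every morphism $f:M\to M$, $\mathrm{Im}(f)$ lies above a direct summand of $M$. $M$ has SIP-extending if for any two subobjects of $M$ which are essential in direct summands of $M$, their intersection is essential in a direct summand of $M$. $M$ has SSP-lifting if for any two subobjects of $M$ which lie above direct summands of $M$, their sum lies above a direct summand of $M$. *)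

theory Defs
  imports "HOL-Algebra.Group"
begin

section \<open>Categories with zero morphisms and addition of parallel morphisms\<close>

record ('o, 'm) pre_additive =
  Obj :: "'o set"
  Arr :: "'m set"
  Dom :: "'m \<Rightarrow> 'o"
  Cod :: "'m \<Rightarrow> 'o"
  Ident :: "'o \<Rightarrow> 'm"
  Comp :: "'m \<Rightarrow> 'm \<Rightarrow> 'm"  (infixl "\<cdot>\<index>" 70)
  Null :: "'o \<Rightarrow> 'o \<Rightarrow> 'm"
  Plus :: "'m \<Rightarrow> 'm \<Rightarrow> 'm"

text \<open>
  Composition is written in the order of application: \<open>g \<cdot>\<^bsub>C\<^esub> f\<close> is \<open>f\<close> followed by \<open>g\<close>.
  Composition and addition are total functions, but their values matter only on composable
  and on parallel arrows, respectively.
\<close>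

definition Hom :: "('o, 'm, 'z) pre_additive_scheme \<Rightarrow> 'o \<Rightarrow> 'o \<Rightarrow> 'm set" where
  "Hom C a b = {f \<in> Arr C. Dom C f = a \<and> Cod C f = b}"

definition hom_group :: "('o, 'm, 'z) pre_additive_scheme \<Rightarrow> 'o \<Rightarrow> 'o \<Rightarrow> 'm monoid" where
  "hom_group C a b = \<lparr>carrier = Hom C a b, mult = Plus C, one = Null C a b\<rparr>"

definition monic :: "('o, 'm, 'z) pre_additive_scheme \<Rightarrow> 'm \<Rightarrow> bool" where
  "monic C f \<longleftrightarrow> f \<in> Arr C \<and>
     (\<forall>a\<in>Obj C. \<forall>g\<in>Hom C a (Dom C f). \<forall>h\<in>Hom C a (Dom C f).
        f \<cdot>\<^bsub>C\<^esub> g = f \<cdot>\<^bsub>C\<^esub> h \<longrightarrow> g = h)"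

definition epic :: "('o, 'm, 'z) pre_additive_scheme \<Rightarrow> 'm \<Rightarrow> bool" where
  "epic C f \<longleftrightarrow> f \<in> Arr C \<and>
     (\<forall>b\<in>Obj C. \<forall>g\<in>Hom C (Cod C f) b. \<forall>h\<in>Hom C (Cod C f) b.
        g \<cdot>\<^bsub>C\<^esub> f = h \<cdot>\<^bsub>C\<^esub> f \<longrightarrow> g = h)"

definition invertible_arr :: "('o, 'm, 'z) pre_additive_scheme \<Rightarrow> 'm \<Rightarrow> bool" where
  "invertible_arr C f \<longleftrightarrow> f \<in> Arr C \<and>
     (\<exists>g\<in>Hom C (Cod C f) (Dom C f).
        g \<cdot>\<^bsub>C\<^esub> f = Ident C (Dom C f) \<and> f \<cdot>\<^bsub>C\<^esub> g = Ident C (Cod C f))"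

definition zero_object :: "('o, 'm, 'z) pre_additive_scheme \<Rightarrow> 'o \<Rightarrow> bool" where
  "zero_object C z \<longleftrightarrow> z \<in> Obj C \<and>
     (\<forall>a\<in>Obj C. (\<exists>!f. f \<in> Hom C a z) \<and> (\<exists>!f. f \<in> Hom C z a))"


section \<open>Universal constructions\<close>

text \<open>
  Kernels, cokernels, images, pullbacks and coproducts are unique only up to isomorphism, so
  they are relations rather than chosen values: \<open>is_kernel C f k\<close> says that \<open>k\<close> is
  \<^emph>\<open>a\<close> kernel of \<open>f\<close>.
\<close>

definition is_kernel :: "('o, 'm, 'z) pre_additive_scheme \<Rightarrow> 'm \<Rightarrow> 'm \<Rightarrow> bool" where
  "is_kernel C f k \<longleftrightarrow> f \<in> Arr C \<and> k \<in> Arr C \<and> Cod C k = Dom C f \<and>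
     f \<cdot>\<^bsub>C\<^esub> k = Null C (Dom C k) (Cod C f) \<and>
     (\<forall>a\<in>Obj C. \<forall>g\<in>Hom C a (Dom C f). f \<cdot>\<^bsub>C\<^esub> g = Null C a (Cod C f) \<longrightarrow>
        (\<exists>!u. u \<in> Hom C a (Dom C k) \<and> k \<cdot>\<^bsub>C\<^esub> u = g))"

definition is_cokernel :: "('o, 'm, 'z) pre_additive_scheme \<Rightarrow> 'm \<Rightarrow> 'm \<Rightarrow> bool" where
  "is_cokernel C f q \<longleftrightarrow> f \<in> Arr C \<and> q \<in> Arr C \<and> Dom C q = Cod C f \<and>
     q \<cdot>\<^bsub>C\<^esub> f = Null C (Dom C f) (Cod C q) \<and>
     (\<forall>b\<in>Obj C. \<forall>g\<in>Hom C (Cod C f) b. g \<cdot>\<^bsub>C\<^esub> f = Null C (Dom C f) b \<longrightarrow>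
        (\<exists>!u. u \<in> Hom C (Cod C q) b \<and> u \<cdot>\<^bsub>C\<^esub> q = g))"

definition is_image :: "('o, 'm, 'z) pre_additive_scheme \<Rightarrow> 'm \<Rightarrow> 'm \<Rightarrow> bool" where
  "is_image C f m \<longleftrightarrow> (\<exists>q. is_cokernel C f q \<and> is_kernel C q m)"

definition is_pullback :: "('o, 'm, 'z) pre_additive_scheme \<Rightarrow> 'm \<Rightarrow> 'm \<Rightarrow> 'm \<Rightarrow> 'm \<Rightarrow> bool" where
  "is_pullback C f g p q \<longleftrightarrow> f \<in> Arr C \<and> g \<in> Arr C \<and> Cod C f = Cod C g \<and>
     p \<in> Hom C (Dom C p) (Dom C f) \<and> q \<in> Hom C (Dom C p) (Dom C g) \<and>
     f \<cdot>\<^bsub>C\<^esub> p = g \<cdot>\<^bsub>C\<^esub> q \<and>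
     (\<forall>a\<in>Obj C. \<forall>s\<in>Hom C a (Dom C f). \<forall>t\<in>Hom C a (Dom C g). f \<cdot>\<^bsub>C\<^esub> s = g \<cdot>\<^bsub>C\<^esub> t \<longrightarrow>
        (\<exists>!u. u \<in> Hom C a (Dom C p) \<and> p \<cdot>\<^bsub>C\<^esub> u = s \<and> q \<cdot>\<^bsub>C\<^esub> u = t))"

definition is_coproduct :: "('o, 'm, 'z) pre_additive_scheme \<Rightarrow> 'o \<Rightarrow> 'o \<Rightarrow> 'm \<Rightarrow> 'm \<Rightarrow> bool" where
  "is_coproduct C a b i j \<longleftrightarrow> i \<in> Hom C a (Cod C i) \<and> j \<in> Hom C b (Cod C i) \<and>
     (\<forall>c\<in>Obj C. \<forall>s\<in>Hom C a c. \<forall>t\<in>Hom C b c.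
        (\<exists>!u. u \<in> Hom C (Cod C i) c \<and> u \<cdot>\<^bsub>C\<^esub> i = s \<and> u \<cdot>\<^bsub>C\<^esub> j = t))"

definition is_biproduct ::
  "('o, 'm, 'z) pre_additive_scheme \<Rightarrow> 'o \<Rightarrow> 'o \<Rightarrow> 'o \<Rightarrow> 'm \<Rightarrow> 'm \<Rightarrow> 'm \<Rightarrow> 'm \<Rightarrow> bool" where
  "is_biproduct C a b c i j p q \<longleftrightarrow>
     i \<in> Hom C a c \<and> j \<in> Hom C b c \<and> p \<in> Hom C c a \<and> q \<in> Hom C c b \<and>
     p \<cdot>\<^bsub>C\<^esub> i = Ident C a \<and> q \<cdot>\<^bsub>C\<^esub> j = Ident C b \<and>
     p \<cdot>\<^bsub>C\<^esub> j = Null C b a \<and> q \<cdot>\<^bsub>C\<^esub> i = Null C a b \<and>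
     Plus C (i \<cdot>\<^bsub>C\<^esub> p) (j \<cdot>\<^bsub>C\<^esub> q) = Ident C c"


section \<open>Abelian categories\<close>

locale cat =
  fixes C :: "('o, 'm, 'z) pre_additive_scheme" (structure)
  assumes Dom_Obj: "f \<in> Arr C \<Longrightarrow> Dom C f \<in> Obj C"
    and Cod_Obj: "f \<in> Arr C \<Longrightarrow> Cod C f \<in> Obj C"
    and Ident_Hom: "a \<in> Obj C \<Longrightarrow> Ident C a \<in> Hom C a a"
    and Comp_Hom: "\<lbrakk>f \<in> Hom C a b; g \<in> Hom C b c\<rbrakk> \<Longrightarrow> g \<cdot> f \<in> Hom C a c"
    and Comp_assoc:
      "\<lbrakk>f \<in> Hom C a b; g \<in> Hom C b c; h \<in> Hom C c d\<rbrakk> \<Longrightarrow> (h \<cdot> g) \<cdot> f = h \<cdot> (g \<cdot> f)"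
    and Comp_Ident_left: "f \<in> Hom C a b \<Longrightarrow> Ident C b \<cdot> f = f"
    and Comp_Ident_right: "f \<in> Hom C a b \<Longrightarrow> f \<cdot> Ident C a = f"

locale preadditive_category = cat +
  assumes hom_comm_group: "\<lbrakk>a \<in> Obj C; b \<in> Obj C\<rbrakk> \<Longrightarrow> comm_group (hom_group C a b)"
    and Comp_Plus_right:
      "\<lbrakk>f \<in> Hom C a b; f' \<in> Hom C a b; g \<in> Hom C b c\<rbrakk>
        \<Longrightarrow> g \<cdot> Plus C f f' = Plus C (g \<cdot> f) (g \<cdot> f')"
    and Comp_Plus_left:
      "\<lbrakk>f \<in> Hom C a b; g \<in> Hom C b c; g' \<in> Hom C b c\<rbrakk>
        \<Longrightarrow> Plus C g g' \<cdot> f = Plus C (g \<cdot> f) (g' \<cdot> f)"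

locale abelian_category = preadditive_category +
  assumes ex_zero_object: "\<exists>z. zero_object C z"
    and ex_biproduct:
      "\<lbrakk>a \<in> Obj C; b \<in> Obj C\<rbrakk> \<Longrightarrow> \<exists>c\<in>Obj C. \<exists>i j p q. is_biproduct C a b c i j p q"
    and ex_kernel: "f \<in> Arr C \<Longrightarrow> \<exists>k. is_kernel C f k"
    and ex_cokernel: "f \<in> Arr C \<Longrightarrow> \<exists>q. is_cokernel C f q"
    and monic_is_kernel: "monic C k \<Longrightarrow> \<exists>f. is_kernel C f k"
    and epic_is_cokernel: "epic C q \<Longrightarrow> \<exists>f. is_cokernel C f q"


section \<open>Subobjects\<close>

text \<open>
  A subobject of \<open>M\<close> is represented by a monomorphism into \<open>M\<close>; two of them represent the same
  subobject if they factor through each other, and every notion below is invariant under this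
  equivalence.  A subobject \<open>x\<close> of \<open>L\<close> is \<open>0\<close> iff its domain is a zero object, and it
  is \<open>L\<close> iff \<open>x\<close> is invertible.
\<close>

definition subobject :: "('o, 'm, 'z) pre_additive_scheme \<Rightarrow> 'm \<Rightarrow> 'o \<Rightarrow> bool" where
  "subobject C k M \<longleftrightarrow> monic C k \<and> Cod C k = M"

definition is_intersection :: "('o, 'm, 'z) pre_additive_scheme \<Rightarrow> 'm \<Rightarrow> 'm \<Rightarrow> 'm \<Rightarrow> bool" where
  "is_intersection C k l m \<longleftrightarrow> (\<exists>p q. is_pullback C k l p q \<and> m = k \<cdot>\<^bsub>C\<^esub> p)"

text \<open>The sum of \<open>k : K \<rightarrow> M\<close> and \<open>l : L \<rightarrow> M\<close> is the image of the morphism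
  \<open>h = [k, l] : K \<oplus> L \<rightarrow> M\<close>.\<close>

definition is_sum :: "('o, 'm, 'z) pre_additive_scheme \<Rightarrow> 'm \<Rightarrow> 'm \<Rightarrow> 'm \<Rightarrow> bool" where
  "is_sum C k l s \<longleftrightarrow> Cod C k = Cod C l \<and>
     (\<exists>i j h. is_coproduct C (Dom C k) (Dom C l) i j \<and>
        h \<in> Hom C (Cod C i) (Cod C k) \<and> h \<cdot>\<^bsub>C\<^esub> i = k \<and> h \<cdot>\<^bsub>C\<^esub> j = l \<and>
        is_image C h s)"

definition direct_summand :: "('o, 'm, 'z) pre_additive_scheme \<Rightarrow> 'm \<Rightarrow> 'o \<Rightarrow> bool" where
  "direct_summand C k M \<longleftrightarrow> subobject C k M \<and>
     (\<exists>k' p p'. is_biproduct C (Dom C k) (Dom C k') M k k' p p')"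

definition essential :: "('o, 'm, 'z) pre_additive_scheme \<Rightarrow> 'm \<Rightarrow> 'o \<Rightarrow> bool" where
  "essential C k L \<longleftrightarrow> subobject C k L \<and>
     (\<forall>x m. subobject C x L \<longrightarrow> is_intersection C k x m \<longrightarrow> zero_object C (Dom C m) \<longrightarrow>
        zero_object C (Dom C x))"

definition superfluous :: "('o, 'm, 'z) pre_additive_scheme \<Rightarrow> 'm \<Rightarrow> 'o \<Rightarrow> bool" where
  "superfluous C k L \<longleftrightarrow> subobject C k L \<and>
     (\<forall>x s. subobject C x L \<longrightarrow> is_sum C k x s \<longrightarrow> invertible_arr C s \<longrightarrow>
        invertible_arr C x)"

text \<open>In the next two definitions \<open>u\<close> is the inclusion between two subobjects of \<open>M\<close>: of
  \<open>k\<close> in the direct summand \<open>d\<close>, and of the direct summand \<open>k\<close> in \<open>l\<close>.\<close>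

definition essential_in_direct_summand ::
  "('o, 'm, 'z) pre_additive_scheme \<Rightarrow> 'm \<Rightarrow> 'o \<Rightarrow> bool" where
  "essential_in_direct_summand C k M \<longleftrightarrow> subobject C k M \<and>
     (\<exists>d u. direct_summand C d M \<and> u \<in> Hom C (Dom C k) (Dom C d) \<and> d \<cdot>\<^bsub>C\<^esub> u = k \<and>
        essential C u (Dom C d))"

text \<open>Here \<open>q : M \<rightarrow> M/K\<close> and \<open>r : L \<rightarrow> L/K\<close> are the quotients, and \<open>v : L/K \<rightarrow> M/K\<close> is the
  morphism induced by \<open>l : L \<rightarrow> M\<close>, which makes \<open>L/K\<close> a subobject of \<open>M/K\<close>.\<close>

definition lies_above_direct_summand ::
  "('o, 'm, 'z) pre_additive_scheme \<Rightarrow> 'm \<Rightarrow> 'o \<Rightarrow> bool" where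
  "lies_above_direct_summand C l M \<longleftrightarrow> subobject C l M \<and>
     (\<exists>k u q r v. direct_summand C k M \<and> u \<in> Hom C (Dom C k) (Dom C l) \<and> l \<cdot>\<^bsub>C\<^esub> u = k \<and>
        is_cokernel C k q \<and> is_cokernel C u r \<and>
        v \<in> Hom C (Cod C r) (Cod C q) \<and> v \<cdot>\<^bsub>C\<^esub> r = q \<cdot>\<^bsub>C\<^esub> l \<and>
        superfluous C v (Cod C q))"


section \<open>CS-Rickart objects\<close>

definition self_CS_Rickart :: "('o, 'm, 'z) pre_additive_scheme \<Rightarrow> 'o \<Rightarrow> bool" where
  "self_CS_Rickart C M \<longleftrightarrow> M \<in> Obj C \<and>
     (\<forall>f\<in>Hom C M M. \<forall>k. is_kernel C f k \<longrightarrow> essential_in_direct_summand C k M)"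

definition dual_self_CS_Rickart :: "('o, 'm, 'z) pre_additive_scheme \<Rightarrow> 'o \<Rightarrow> bool" where
  "dual_self_CS_Rickart C M \<longleftrightarrow> M \<in> Obj C \<and>
     (\<forall>f\<in>Hom C M M. \<forall>m. is_image C f m \<longrightarrow> lies_above_direct_summand C m M)"

definition SIP_extending :: "('o, 'm, 'z) pre_additive_scheme \<Rightarrow> 'o \<Rightarrow> bool" where
  "SIP_extending C M \<longleftrightarrow> M \<in> Obj C \<and>
     (\<forall>k l m. essential_in_direct_summand C k M \<longrightarrow> essential_in_direct_summand C l M \<longrightarrow>
        is_intersection C k l m \<longrightarrow> essential_in_direct_summand C m M)"

definition SSP_lifting :: "('o, 'm, 'z) pre_additive_scheme \<Rightarrow> 'o \<Rightarrow> bool" where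
  "SSP_lifting C M \<longleftrightarrow> M \<in> Obj C \<and>
     (\<forall>k l s. lies_above_direct_summand C k M \<longrightarrow> lies_above_direct_summand C l M \<longrightarrow>
        is_sum C k l s \<longrightarrow> lies_above_direct_summand C s M)"

end

theory Submission
  imports Defs
begin

text \<open>
  Part (1).  Think of subobjects of \<open>M\<close> as submodules.  Let \<open>K\<close> be essential in a direct
  summand \<open>D\<close>, with \<open>M = D \<oplus> D'\<close>, and \<open>L\<close> essential in a direct summand \<open>F\<close>, with
  \<open>M = F \<oplus> F'\<close>.  Let \<open>g\<close> be the projection onto \<open>D\<close> followed by the projection onto \<open>F'\<close>,
  both regarded as endomorphisms of \<open>M\<close>.  Then \<open>Ker g = (D \<inter> F) \<oplus> D'\<close>, and the hypothesis
  on \<open>M\<close> makes it essential in a direct summand \<open>N\<close>.  Since \<open>N\<close> contains the complement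
  \<open>D'\<close> of \<open>D\<close>, the modular law gives \<open>N = (N \<inter> D) \<oplus> D'\<close>, so \<open>Y = N \<inter> D\<close> is a direct
  summand of \<open>M\<close> (\<open>ex_split_intersection_if_complement_le\<close>).  Intersecting with \<open>D\<close> shows
  that \<open>D \<inter> F\<close> is essential in \<open>Y\<close>; and \<open>K \<inter> L\<close> is essential in \<open>D \<inter> F\<close>
  (\<open>essential_intersection\<close>), hence in \<open>Y\<close>.

  The element arguments become arguments about test monomorphisms: \<open>u : K \<rightarrow> L\<close> is essential iff
  every monomorphism into \<open>L\<close> from a nonzero object can be restricted to a nonzero subobject so
  that it factors through \<open>u\<close> (\<open>essential_iff\<close>).

  Part (2) is part (1) for the opposite category.  The definitions of the two halves are not
  literally dual, because both are phrased with subobjects.  The translation sends a subobject to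
  its cokernel: \<open>L\<close> is superfluous iff its cokernel is essential in the opposite category
  (\<open>superfluous_iff_essential_cokernel\<close>), \<open>L\<close> lies above a direct summand iff its cokernel is
  essential in a direct summand there (\<open>lies_above_iff_cokernel_essential\<close>), and the cokernel of
  a sum is the intersection, there, of the cokernels (\<open>is_intersection_opposite_cokernels_of_sum\<close>).
\<close>

section \<open>Arrows and cancellation\<close>

context cat
begin

lemma Hom_Obj: "f \<in> Hom C a b \<Longrightarrow> a \<in> Obj C" "f \<in> Hom C a b \<Longrightarrow> b \<in> Obj C"
  using Dom_Obj Cod_Obj by (auto simp: Hom_def)

lemma HomD: "f \<in> Hom C a b \<Longrightarrow> f \<in> Arr C" "f \<in> Hom C a b \<Longrightarrow> Dom C f = a"
    "f \<in> Hom C a b \<Longrightarrow> Cod C f = b"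
  by (auto simp: Hom_def)

lemma Arr_Hom: "f \<in> Arr C \<Longrightarrow> f \<in> Hom C (Dom C f) (Cod C f)"
  by (simp add: Hom_def)

lemma monicI:
  assumes "f \<in> Hom C a b"
    and "\<And>c g h. \<lbrakk>g \<in> Hom C c a; h \<in> Hom C c a; f \<cdot> g = f \<cdot> h\<rbrakk> \<Longrightarrow> g = h"
  shows "monic C f"
  using assms by (auto simp: monic_def Hom_def)

lemma monic_cancel:
  assumes "monic C f" "f \<in> Hom C a b" "g \<in> Hom C c a" "h \<in> Hom C c a" "f \<cdot> g = f \<cdot> h"
  shows "g = h"
  using assms Hom_Obj[OF assms(3)] by (auto simp: monic_def HomD)

lemma epicI:
  assumes "f \<in> Hom C a b"
    and "\<And>c g h. \<lbrakk>g \<in> Hom C b c; h \<in> Hom C b c; g \<cdot> f = h \<cdot> f\<rbrakk> \<Longrightarrow> g = h"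
  shows "epic C f"
  using assms by (auto simp: epic_def Hom_def)

lemma epic_cancel:
  assumes "epic C f" "f \<in> Hom C a b" "g \<in> Hom C b c" "h \<in> Hom C b c" "g \<cdot> f = h \<cdot> f"
  shows "g = h"
  using assms Hom_Obj[OF assms(3)] by (auto simp: epic_def HomD)

lemma monic_Comp:
  assumes f: "f \<in> Hom C a b" "monic C f" and g: "g \<in> Hom C b c" "monic C g"
  shows "monic C (g \<cdot> f)"
proof (rule monicI[OF Comp_Hom[OF f(1) g(1)]])
  fix e s t assume st: "s \<in> Hom C e a" "t \<in> Hom C e a" "(g \<cdot> f) \<cdot> s = (g \<cdot> f) \<cdot> t"
  then have "g \<cdot> (f \<cdot> s) = g \<cdot> (f \<cdot> t)"
    using Comp_assoc[OF st(1) f(1) g(1)] Comp_assoc[OF st(2) f(1) g(1)] by simp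
  then have "f \<cdot> s = f \<cdot> t" using monic_cancel[OF g(2,1)] st f Comp_Hom by blast
  then show "s = t" using monic_cancel[OF f(2,1)] st by blast
qed

lemma monic_right_factor:
  assumes f: "f \<in> Hom C a b" and g: "g \<in> Hom C b c" and gf: "monic C (g \<cdot> f)"
  shows "monic C f"
proof (rule monicI[OF f])
  fix e s t assume st: "s \<in> Hom C e a" "t \<in> Hom C e a" "f \<cdot> s = f \<cdot> t"
  then have "(g \<cdot> f) \<cdot> s = (g \<cdot> f) \<cdot> t"
    using Comp_assoc[OF st(1) f g] Comp_assoc[OF st(2) f g] by simp
  then show "s = t" using monic_cancel[OF gf Comp_Hom[OF f g]] st by blast
qed

lemma epic_left_factor:
  assumes f: "f \<in> Hom C a b" and g: "g \<in> Hom C b c" and gf: "epic C (g \<cdot> f)"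
  shows "epic C g"
proof (rule epicI[OF g])
  fix e s t assume st: "s \<in> Hom C c e" "t \<in> Hom C c e" "s \<cdot> g = t \<cdot> g"
  then have "s \<cdot> (g \<cdot> f) = t \<cdot> (g \<cdot> f)"
    using Comp_assoc[OF f g st(1)] Comp_assoc[OF f g st(2)] by simp
  then show "s = t" using epic_cancel[OF gf Comp_Hom[OF f g]] st by blast
qed

lemma monic_split:
  assumes d: "d \<in> Hom C a b" and r: "r \<in> Hom C b a" and "r \<cdot> d = Ident C a"
  shows "monic C d"
proof (rule monic_right_factor[OF d r])
  show "monic C (r \<cdot> d)"
    using assms(3) monicI[OF Comp_Hom[OF d r]] Comp_Ident_left by simp
qed

lemma epic_split:
  assumes d: "d \<in> Hom C a b" and r: "r \<in> Hom C b a" and "r \<cdot> d = Ident C a"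
  shows "epic C r"
proof (rule epic_left_factor[OF d r])
  show "epic C (r \<cdot> d)"
    using assms(3) epicI[OF Comp_Hom[OF d r]] Comp_Ident_right by simp
qed

lemma invertible_if_split_monic:
  assumes f: "f \<in> Hom C a b" "monic C f" and g: "g \<in> Hom C b a" "f \<cdot> g = Ident C b"
  shows "invertible_arr C f"
proof -
  have "f \<cdot> (g \<cdot> f) = f \<cdot> Ident C a"
    using Comp_assoc[OF f(1) g(1) f(1)] g(2) Comp_Ident_left[OF f(1)] Comp_Ident_right[OF f(1)] by simp
  then have "g \<cdot> f = Ident C a"
    using monic_cancel[OF f(2,1)] Comp_Hom[OF f(1) g(1)] Ident_Hom Hom_Obj[OF f(1)] by blast
  then show ?thesis using f g unfolding invertible_arr_def by (auto simp: HomD)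
qed

lemma pullback_factor:
  assumes "is_pullback C f g p q" "f \<in> Hom C b d" "g \<in> Hom C c d"
    and "s \<in> Hom C a b" "t \<in> Hom C a c" "f \<cdot> s = g \<cdot> t"
  obtains u where "u \<in> Hom C a (Dom C p)" "p \<cdot> u = s" "q \<cdot> u = t"
  using assms Hom_Obj[OF assms(4)] unfolding is_pullback_def by (metis HomD(2))

lemma pullback_monic:
  assumes pq: "is_pullback C k l p q" and k: "monic C k" "k \<in> Hom C K M"
    and l: "monic C l" "l \<in> Hom C L M"
  shows "monic C (k \<cdot> p)"
proof -
  have pH: "p \<in> Hom C (Dom C p) K" and qH: "q \<in> Hom C (Dom C p) L" and sq: "k \<cdot> p = l \<cdot> q"
    using pq HomD[OF k(2)] HomD[OF l(2)] by (auto simp: is_pullback_def)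
  show ?thesis
  proof (rule monicI[OF Comp_Hom[OF pH k(2)]])
    fix c s t assume st: "s \<in> Hom C c (Dom C p)" "t \<in> Hom C c (Dom C p)"
      "(k \<cdot> p) \<cdot> s = (k \<cdot> p) \<cdot> t"
    have "k \<cdot> (p \<cdot> s) = k \<cdot> (p \<cdot> t)"
      using st Comp_assoc[OF st(1) pH k(2)] Comp_assoc[OF st(2) pH k(2)] by simp
    then have 1: "p \<cdot> s = p \<cdot> t"
      using monic_cancel[OF k] Comp_Hom[OF st(1) pH] Comp_Hom[OF st(2) pH] by blast
    have "l \<cdot> (q \<cdot> s) = l \<cdot> (q \<cdot> t)"
      using st sq Comp_assoc[OF st(1) qH l(2)] Comp_assoc[OF st(2) qH l(2)] by simp
    then have 2: "q \<cdot> s = q \<cdot> t"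
      using monic_cancel[OF l] Comp_Hom[OF st(1) qH] Comp_Hom[OF st(2) qH] by blast
    have "k \<cdot> (p \<cdot> s) = l \<cdot> (q \<cdot> s)"
      using Comp_assoc[OF st(1) pH k(2)] Comp_assoc[OF st(1) qH l(2)] sq by simp
    then have "\<exists>!x. x \<in> Hom C c (Dom C p) \<and> p \<cdot> x = p \<cdot> s \<and> q \<cdot> x = q \<cdot> s"
      using pq Hom_Obj(1)[OF st(1)] Comp_Hom[OF st(1) pH] Comp_Hom[OF st(1) qH]
        HomD(2)[OF k(2)] HomD(2)[OF l(2)]
      unfolding is_pullback_def by blast
    then show "s = t" using st 1 2 by metis
  qed
qed

end


section \<open>Zero morphisms, kernels and cokernels\<close>

context preadditive_category
begin

lemma Null_Hom: "\<lbrakk>a \<in> Obj C; b \<in> Obj C\<rbrakk> \<Longrightarrow> Null C a b \<in> Hom C a b"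
  using comm_group.axioms(2)[OF hom_comm_group, of a b, THEN group.is_monoid, THEN monoid.one_closed]
  by (simp add: hom_group_def)

lemma Plus_Hom: "\<lbrakk>f \<in> Hom C a b; g \<in> Hom C a b\<rbrakk> \<Longrightarrow> Plus C f g \<in> Hom C a b"
  using comm_group.axioms(2)[OF hom_comm_group, of a b, THEN group.is_monoid, THEN monoid.m_closed]
  by (simp add: hom_group_def Hom_Obj)

lemma Plus_Null_left: "f \<in> Hom C a b \<Longrightarrow> Plus C (Null C a b) f = f"
  using comm_group.axioms(2)[OF hom_comm_group, of a b, THEN group.is_monoid, THEN monoid.l_one]
  by (simp add: hom_group_def Hom_Obj)

lemma Plus_Null_right: "f \<in> Hom C a b \<Longrightarrow> Plus C f (Null C a b) = f"
  using comm_group.axioms(2)[OF hom_comm_group, of a b, THEN group.is_monoid, THEN monoid.r_one]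
  by (simp add: hom_group_def Hom_Obj)

lemma Plus_left_cancel:
  "\<lbrakk>f \<in> Hom C a b; g \<in> Hom C a b; h \<in> Hom C a b; Plus C f g = Plus C f h\<rbrakk> \<Longrightarrow> g = h"
  using comm_group.axioms(2)[OF hom_comm_group, of a b, THEN group.is_monoid,
      THEN monoid.Units_l_cancel, of f g h]
    comm_group.axioms(2)[OF hom_comm_group, of a b, THEN group.Units_eq]
  by (simp add: hom_group_def Hom_Obj)

lemma Plus_right_cancel:
  "\<lbrakk>f \<in> Hom C a b; g \<in> Hom C a b; h \<in> Hom C a b; Plus C g f = Plus C h f\<rbrakk> \<Longrightarrow> g = h"
  using comm_group.axioms(2)[OF hom_comm_group, of a b, THEN group.right_cancel, of f g h]
  by (simp add: hom_group_def Hom_Obj)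

lemma ex_difference:
  assumes "f \<in> Hom C a b" "g \<in> Hom C a b"
  shows "\<exists>h\<in>Hom C a b. Plus C f h = g"
proof -
  interpret G: comm_group "hom_group C a b"
    using hom_comm_group assms Hom_Obj by blast
  have "f \<in> carrier (hom_group C a b)" "g \<in> carrier (hom_group C a b)"
    using assms by (auto simp: hom_group_def)
  then have "inv\<^bsub>hom_group C a b\<^esub> f \<otimes>\<^bsub>hom_group C a b\<^esub> g \<in> carrier (hom_group C a b)"
    "f \<otimes>\<^bsub>hom_group C a b\<^esub> (inv\<^bsub>hom_group C a b\<^esub> f \<otimes>\<^bsub>hom_group C a b\<^esub> g) = g"
    by (auto simp: G.m_assoc[symmetric])
  then show ?thesis by (auto simp: hom_group_def)
qed

lemma Comp_Null_right:
  assumes "g \<in> Hom C b c" "a \<in> Obj C"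
  shows "g \<cdot> Null C a b = Null C a c"
proof -
  have N: "Null C a b \<in> Hom C a b" "Null C a c \<in> Hom C a c"
    using assms Null_Hom Hom_Obj by blast+
  have gN: "g \<cdot> Null C a b \<in> Hom C a c" using Comp_Hom N assms by blast
  have "Plus C (g \<cdot> Null C a b) (g \<cdot> Null C a b) = Plus C (g \<cdot> Null C a b) (Null C a c)"
    using Comp_Plus_right[OF N(1) N(1) assms(1)] Plus_Null_left[OF N(1)] Plus_Null_right[OF gN]
    by simp
  then show ?thesis using Plus_left_cancel gN N by blast
qed

lemma Comp_Null_left:
  assumes "f \<in> Hom C a b" "c \<in> Obj C"
  shows "Null C b c \<cdot> f = Null C a c"
proof -
  have N: "Null C b c \<in> Hom C b c" "Null C a c \<in> Hom C a c"
    using assms Null_Hom Hom_Obj by blast+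
  have Nf: "Null C b c \<cdot> f \<in> Hom C a c" using Comp_Hom N assms by blast
  have "Plus C (Null C b c \<cdot> f) (Null C b c \<cdot> f) = Plus C (Null C b c \<cdot> f) (Null C a c)"
    using Comp_Plus_left[OF assms(1) N(1) N(1)] Plus_Null_left[OF N(1)] Plus_Null_right[OF Nf]
    by simp
  then show ?thesis using Plus_left_cancel Nf N by blast
qed

lemma zero_object_iff: "zero_object C z \<longleftrightarrow> z \<in> Obj C \<and> Ident C z = Null C z z"
proof
  assume "zero_object C z"
  then show "z \<in> Obj C \<and> Ident C z = Null C z z"
    unfolding zero_object_def using Ident_Hom Null_Hom by blast
next
  assume z: "z \<in> Obj C \<and> Ident C z = Null C z z"
  have "f = Null C a z" if "f \<in> Hom C a z" for f a
    using Comp_Ident_left[OF that] Comp_Null_left[OF that] z by metis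
  moreover have "f = Null C z a" if "f \<in> Hom C z a" for f a
    using Comp_Ident_right[OF that] Comp_Null_right[OF that] z by metis
  ultimately show "zero_object C z"
    unfolding zero_object_def using z Null_Hom by metis
qed

lemma zero_object_Hom:
  assumes "zero_object C z"
  shows "f \<in> Hom C a z \<Longrightarrow> f = Null C a z" "f \<in> Hom C z a \<Longrightarrow> f = Null C z a"
  using assms Comp_Ident_left[of f a z] Comp_Ident_right[of f z a]
    Comp_Null_left[of f a z z] Comp_Null_right[of f z a z]
  unfolding zero_object_iff by metis+

lemma zero_object_monic:
  assumes f: "f \<in> Hom C a b" "monic C f" and b: "zero_object C b"
  shows "zero_object C a"
proof -
  have a: "a \<in> Obj C" using f Hom_Obj by blast
  have "f \<cdot> Ident C a = f \<cdot> Null C a a"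
    using zero_object_Hom(1)[OF b Comp_Hom[OF Ident_Hom[OF a] f(1)]]
      zero_object_Hom(1)[OF b Comp_Hom[OF Null_Hom[OF a a] f(1)]] by simp
  then have "Ident C a = Null C a a"
    using monic_cancel[OF f(2,1)] Ident_Hom[OF a] Null_Hom[OF a a] by blast
  then show ?thesis using a zero_object_iff by blast
qed

lemma epic_Null_zero_object:
  assumes "epic C (Null C a b)" "a \<in> Obj C" "b \<in> Obj C"
  shows "zero_object C b"
proof -
  have "Ident C b \<cdot> Null C a b = Null C b b \<cdot> Null C a b"
    using Comp_Ident_left Comp_Null_left Null_Hom assms by metis
  then have "Ident C b = Null C b b"
    using epic_cancel[OF assms(1) Null_Hom] Ident_Hom Null_Hom assms by blast
  then show ?thesis using assms zero_object_iff by blast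
qed

lemma kernelD:
  assumes "is_kernel C f k" "f \<in> Hom C a b"
  shows "k \<in> Hom C (Dom C k) a" "f \<cdot> k = Null C (Dom C k) b"
  using assms by (auto simp: is_kernel_def Hom_def)

lemma kernel_factor:
  assumes "is_kernel C f k" "f \<in> Hom C a b" "g \<in> Hom C c a" "f \<cdot> g = Null C c b"
  obtains u where "u \<in> Hom C c (Dom C k)" "k \<cdot> u = g"
  using assms Hom_Obj[OF assms(3)] unfolding is_kernel_def by (metis HomD(2,3))

lemma kernel_monic:
  assumes "is_kernel C f k"
  shows "monic C k"
proof -
  have f: "f \<in> Hom C (Dom C f) (Cod C f)" using assms by (simp add: is_kernel_def Arr_Hom)
  note k = kernelD[OF assms f]
  show ?thesis
  proof (rule monicI[OF k(1)])
    fix c g h assume gh: "g \<in> Hom C c (Dom C k)" "h \<in> Hom C c (Dom C k)" "k \<cdot> g = k \<cdot> h"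
    have "f \<cdot> (k \<cdot> g) = Null C c (Cod C f)"
      using Comp_assoc[OF gh(1) k(1) f] k(2) Comp_Null_left[OF gh(1)] Hom_Obj[OF f] by simp
    moreover have "k \<cdot> g \<in> Hom C c (Dom C f)" using Comp_Hom gh k by blast
    ultimately have "\<exists>!u. u \<in> Hom C c (Dom C k) \<and> k \<cdot> u = k \<cdot> g"
      using assms Hom_Obj[OF gh(1)] unfolding is_kernel_def by blast
    then show "g = h" using gh by metis
  qed
qed

lemma is_kernelI:
  assumes f: "f \<in> Hom C a b" and k: "k \<in> Hom C c a" "monic C k" "f \<cdot> k = Null C c b"
    and ex: "\<And>d g. \<lbrakk>g \<in> Hom C d a; f \<cdot> g = Null C d b\<rbrakk> \<Longrightarrow> \<exists>u\<in>Hom C d c. k \<cdot> u = g"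
  shows "is_kernel C f k"
proof -
  have "\<exists>!u. u \<in> Hom C d c \<and> k \<cdot> u = g" if g: "g \<in> Hom C d a" "f \<cdot> g = Null C d b" for d g
    using ex[OF g] monic_cancel[OF k(2,1)] by blast
  then show ?thesis unfolding is_kernel_def using HomD[OF f] HomD[OF k(1)] k(3) by simp
qed

lemma cokernelD:
  assumes "is_cokernel C f q" "f \<in> Hom C a b"
  shows "q \<in> Hom C b (Cod C q)" "q \<cdot> f = Null C a (Cod C q)"
  using assms by (auto simp: is_cokernel_def Hom_def)

lemma cokernel_factor:
  assumes "is_cokernel C f q" "f \<in> Hom C a b" "g \<in> Hom C b c" "g \<cdot> f = Null C a c"
  obtains u where "u \<in> Hom C (Cod C q) c" "u \<cdot> q = g"
  using assms Hom_Obj[OF assms(3)] unfolding is_cokernel_def by (metis HomD(2,3))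

lemma is_cokernelI:
  assumes f: "f \<in> Hom C a b" and q: "q \<in> Hom C b c" "epic C q" "q \<cdot> f = Null C a c"
    and ex: "\<And>d g. \<lbrakk>g \<in> Hom C b d; g \<cdot> f = Null C a d\<rbrakk> \<Longrightarrow> \<exists>u\<in>Hom C c d. u \<cdot> q = g"
  shows "is_cokernel C f q"
proof -
  have "\<exists>!u. u \<in> Hom C c d \<and> u \<cdot> q = g" if g: "g \<in> Hom C b d" "g \<cdot> f = Null C a d" for d g
    using ex[OF g] epic_cancel[OF q(2,1)] by blast
  then show ?thesis unfolding is_cokernel_def using HomD[OF f] HomD[OF q(1)] q(3) by simp
qed

end

text \<open>
  A monomorphism is the kernel of some \<open>f\<close>; since \<open>f\<close> factors through the cokernel \<open>q\<close>, every
  arrow killed by \<open>q\<close> is killed by \<open>f\<close>.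
\<close>

lemma (in abelian_category) monic_kernel_of_cokernel:
  assumes k: "monic C k" and q: "is_cokernel C k q"
  shows "is_kernel C q k"
proof -
  obtain f where f: "is_kernel C f k" using monic_is_kernel[OF k] by blast
  have fH: "f \<in> Hom C (Dom C f) (Cod C f)" using f by (simp add: is_kernel_def Arr_Hom)
  note k' = kernelD[OF f fH] and q' = cokernelD[OF q kernelD(1)[OF f fH]]
  obtain w where w: "w \<in> Hom C (Cod C q) (Cod C f)" "w \<cdot> q = f"
    using cokernel_factor[OF q k'(1) fH k'(2)] .
  show ?thesis
  proof (rule is_kernelI[OF q'(1) k'(1) k q'(2)])
    fix d g assume g: "g \<in> Hom C d (Dom C f)" "q \<cdot> g = Null C d (Cod C q)"
    have "f \<cdot> g = Null C d (Cod C f)"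
      using w g Comp_assoc[OF g(1) q'(1) w(1)] Comp_Null_right[OF w(1)] Hom_Obj by metis
    then show "\<exists>u\<in>Hom C d (Dom C k). k \<cdot> u = g"
      using kernel_factor[OF f fH g(1)] by blast
  qed
qed


section \<open>The opposite category\<close>

definition opposite :: "('o, 'm, 'z) pre_additive_scheme \<Rightarrow> ('o, 'm, 'z) pre_additive_scheme" where
  "opposite C = C\<lparr>Dom := Cod C, Cod := Dom C, Comp := (\<lambda>g f. f \<cdot>\<^bsub>C\<^esub> g),
     Null := (\<lambda>a b. Null C b a)\<rparr>"

lemma opposite_simps [simp]:
  "Obj (opposite C) = Obj C" "Arr (opposite C) = Arr C" "Dom (opposite C) = Cod C"
  "Cod (opposite C) = Dom C" "Ident (opposite C) = Ident C" "g \<cdot>\<^bsub>opposite C\<^esub> f = f \<cdot>\<^bsub>C\<^esub> g"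
  "Null (opposite C) a b = Null C b a" "Plus (opposite C) = Plus C"
  by (simp_all add: opposite_def)

lemma Hom_opposite [simp]: "Hom (opposite C) a b = Hom C b a"
  by (auto simp: Hom_def)

lemma monic_opposite [simp]: "monic (opposite C) f = epic C f"
  by (simp add: monic_def epic_def)

lemma epic_opposite [simp]: "epic (opposite C) f = monic C f"
  by (simp add: monic_def epic_def)

lemma zero_object_opposite [simp]: "zero_object (opposite C) z = zero_object C z"
  by (auto simp: zero_object_def)

lemma is_kernel_opposite [simp]: "is_kernel (opposite C) f k = is_cokernel C f k"
  by (simp add: is_kernel_def is_cokernel_def)

lemma is_cokernel_opposite [simp]: "is_cokernel (opposite C) f k = is_kernel C f k"
  by (simp add: is_kernel_def is_cokernel_def)

lemma is_biproduct_opposite [simp]: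
  "is_biproduct (opposite C) a b c i j p q = is_biproduct C a b c p q i j"
  by (auto simp: is_biproduct_def)

lemma hom_group_opposite [simp]: "hom_group (opposite C) a b = hom_group C b a"
  by (simp add: hom_group_def)

lemma (in abelian_category) abelian_opposite: "abelian_category (opposite C)"
proof (intro abelian_category.intro preadditive_category.intro cat.intro
    preadditive_category_axioms.intro abelian_category_axioms.intro)
  show "epic (opposite C) q \<Longrightarrow> \<exists>f. is_cokernel (opposite C) f q" for q
    using monic_is_kernel by simp
  show "monic (opposite C) q \<Longrightarrow> \<exists>f. is_kernel (opposite C) f q" for q
    using epic_is_cokernel by simp
  show "\<exists>c\<in>Obj (opposite C). \<exists>i j p q. is_biproduct (opposite C) a b c i j p q"
    if "a \<in> Obj (opposite C)" "b \<in> Obj (opposite C)" for a b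
    using ex_biproduct[of a b] that by simp blast
  show "(h \<cdot>\<^bsub>opposite C\<^esub> g) \<cdot>\<^bsub>opposite C\<^esub> f = h \<cdot>\<^bsub>opposite C\<^esub> (g \<cdot>\<^bsub>opposite C\<^esub> f)"
    if "f \<in> Hom (opposite C) a b" "g \<in> Hom (opposite C) b c" "h \<in> Hom (opposite C) c d"
    for f g h a b c d
    using that Comp_assoc by (metis Hom_opposite opposite_simps(6))
qed (use Dom_Obj Cod_Obj Ident_Hom Comp_Hom Comp_Ident_left Comp_Ident_right hom_comm_group
      Comp_Plus_right Comp_Plus_left ex_zero_object ex_kernel ex_cokernel in \<open>auto\<close>)

context abelian_category
begin

lemma cokernel_epic:
  assumes "is_cokernel C f q"
  shows "epic C q"
proof -
  interpret op: abelian_category "opposite C" by (rule abelian_opposite)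
  show ?thesis using op.kernel_monic[of f q] assms by simp
qed

lemma epic_cokernel_of_kernel:
  assumes "epic C q" "is_kernel C q k"
  shows "is_cokernel C k q"
proof -
  interpret op: abelian_category "opposite C" by (rule abelian_opposite)
  show ?thesis using op.monic_kernel_of_cokernel[of q k] assms by simp
qed

lemma invertible_iff_cokernel_zero:
  assumes s: "s \<in> Hom C a b" "monic C s" and q: "is_cokernel C s q"
  shows "invertible_arr C s \<longleftrightarrow> zero_object C (Cod C q)"
proof
  note q' = cokernelD[OF q s(1)]
  assume "invertible_arr C s"
  then obtain g where g: "g \<in> Hom C b a" "s \<cdot> g = Ident C b"
    using s by (auto simp: invertible_arr_def HomD)
  have "q = (q \<cdot> s) \<cdot> g" using Comp_assoc[OF g(1) s(1) q'(1)] g Comp_Ident_right[OF q'(1)] by simp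
  then have "q = Null C b (Cod C q)"
    using q' Comp_Null_left[OF g(1)] Hom_Obj[OF q'(1)] by simp
  then show "zero_object C (Cod C q)"
    using epic_Null_zero_object cokernel_epic[OF q] Hom_Obj[OF q'(1)] by metis
next
  note q' = cokernelD[OF q s(1)]
  assume z: "zero_object C (Cod C q)"
  have b: "b \<in> Obj C" using Hom_Obj s by blast
  have "q \<cdot> Ident C b = Null C b (Cod C q)"
    using zero_object_Hom(1)[OF z] q' Comp_Ident_right by metis
  then obtain g where "g \<in> Hom C b (Dom C s)" "s \<cdot> g = Ident C b"
    using kernel_factor[OF monic_kernel_of_cokernel[OF s(2) q] q'(1) Ident_Hom[OF b]] by metis
  then show "invertible_arr C s"
    using invertible_if_split_monic[OF s] s by (simp add: HomD)
qed

section \<open>Direct summands and essential subobjects\<close>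

text \<open>
  The complement of \<open>d\<close> is the kernel of its retraction \<open>r\<close>: the difference \<open>e = 1 - d r\<close> is
  killed by \<open>r\<close>, and its factorization through that kernel is the second projection.
\<close>

lemma direct_summand_if_split:
  assumes d: "d \<in> Hom C a M" and r: "r \<in> Hom C M a" and rd: "r \<cdot> d = Ident C a"
  shows "direct_summand C d M"
proof -
  obtain k where k: "is_kernel C r k" using ex_kernel HomD r by blast
  define b where "b = Dom C k"
  note kH = kernelD[OF k r, folded b_def]
  have obj: "M \<in> Obj C" "a \<in> Obj C" "b \<in> Obj C" using Hom_Obj d kH by blast+
  have dr: "d \<cdot> r \<in> Hom C M M" using Comp_Hom d r by blast
  obtain e where e: "e \<in> Hom C M M" "Plus C (d \<cdot> r) e = Ident C M"
    using ex_difference[OF dr Ident_Hom[OF obj(1)]] by blast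
  have "Plus C r (r \<cdot> e) = Plus C r (Null C M a)"
  proof -
    have "r \<cdot> (d \<cdot> r) = r" using Comp_assoc[OF r d r] rd Comp_Ident_left[OF r] by simp
    then show ?thesis
      using Comp_Plus_right[OF dr e(1) r] e Comp_Ident_right[OF r] Plus_Null_right[OF r] by simp
  qed
  then have re: "r \<cdot> e = Null C M a"
    using Plus_left_cancel r Comp_Hom[OF e(1) r] Null_Hom obj by blast
  obtain p where p: "p \<in> Hom C M b" "k \<cdot> p = e"
    using kernel_factor[OF k r e(1) re] unfolding b_def .
  have ek: "e \<cdot> k = k"
  proof -
    have "(d \<cdot> r) \<cdot> k = Null C b M"
      using Comp_assoc[OF kH(1) r d] kH(2) Comp_Null_right[OF d] obj by simp
    then show ?thesis
      using Comp_Plus_left[OF kH(1) dr e(1)] e(2) Comp_Ident_left[OF kH(1)]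
        Plus_Null_left[OF Comp_Hom[OF kH(1) e(1)]] by simp
  qed
  have pk: "p \<cdot> k = Ident C b"
  proof (rule monic_cancel[OF kernel_monic[OF k] kH(1)])
    show "k \<cdot> (p \<cdot> k) = k \<cdot> Ident C b"
      using ek p Comp_assoc[OF kH(1) p(1) kH(1)] Comp_Ident_right[OF kH(1)] by simp
  qed (use Comp_Hom[OF kH(1) p(1)] Ident_Hom obj in auto)
  have pd: "p \<cdot> d = Null C a b"
  proof (rule monic_cancel[OF kernel_monic[OF k] kH(1)])
    have "(d \<cdot> r) \<cdot> d = d" using Comp_assoc[OF d r d] rd Comp_Ident_right[OF d] by simp
    then have "Plus C d (e \<cdot> d) = Plus C d (Null C a M)"
      using Comp_Plus_left[OF d dr e(1)] e(2) Comp_Ident_left[OF d] Plus_Null_right[OF d] by simp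
    then have "e \<cdot> d = Null C a M"
      using Plus_left_cancel d Comp_Hom[OF d e(1)] Null_Hom obj by blast
    then show "k \<cdot> (p \<cdot> d) = k \<cdot> Null C a b"
      using p Comp_assoc[OF d p(1) kH(1)] Comp_Null_right[OF kH(1)] obj by simp
  qed (use Comp_Hom[OF d p(1)] Null_Hom obj in auto)
  have "is_biproduct C a b M d k r p"
    unfolding is_biproduct_def using d r rd p pk pd kH e by simp
  then show ?thesis
    unfolding direct_summand_def subobject_def
    using monic_split[OF d r rd] HomD d b_def by metis
qed

lemma direct_summandE:
  assumes "direct_summand C d M"
  obtains b d' r r' where "is_biproduct C (Dom C d) b M d d' r r'"
  using assms unfolding direct_summand_def by blast

text \<open>
  The preimage of \<open>u = ker f\<close> under \<open>x\<close> is \<open>ker (f x)\<close>.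
\<close>

lemma ex_pullback_of_monic:
  assumes u: "u \<in> Hom C a c" "monic C u" and x: "x \<in> Hom C b c"
  obtains p q where "is_pullback C u x p q" "monic C q"
proof -
  obtain f where f: "is_kernel C f u" using monic_is_kernel u by blast
  have fH: "f \<in> Hom C c (Cod C f)" using f u Arr_Hom by (metis is_kernel_def HomD(3))
  define z where "z = Cod C f"
  have fH: "f \<in> Hom C c z" using fH z_def by simp
  have fx: "f \<cdot> x \<in> Hom C b z" using Comp_Hom fH x by blast
  obtain q where q: "is_kernel C (f \<cdot> x) q" using ex_kernel fx HomD by blast
  define d where "d = Dom C q"
  note qH = kernelD[OF q fx, folded d_def]
  have "f \<cdot> (x \<cdot> q) = Null C d z" using qH Comp_assoc[OF qH(1) x fH] by simp
  then obtain p where p: "p \<in> Hom C d a" "u \<cdot> p = x \<cdot> q"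
    using kernel_factor[OF f fH Comp_Hom[OF qH(1) x]] u HomD by metis
  have "\<exists>w\<in>Hom C e d. p \<cdot> w = s \<and> q \<cdot> w = t"
    if st: "s \<in> Hom C e a" "t \<in> Hom C e b" "u \<cdot> s = x \<cdot> t" for e s t
  proof -
    have "(f \<cdot> x) \<cdot> t = (f \<cdot> u) \<cdot> s"
      using Comp_assoc[OF st(2) x fH] Comp_assoc[OF st(1) u(1) fH] st(3) by simp
    also have "\<dots> = Null C e z"
      using kernelD[OF f fH] Comp_Null_left[OF st(1)] Hom_Obj[OF fH] u HomD by metis
    finally obtain w where w: "w \<in> Hom C e d" "q \<cdot> w = t"
      using kernel_factor[OF q fx st(2)] d_def by metis
    have "u \<cdot> (p \<cdot> w) = u \<cdot> s"
      using Comp_assoc[OF w(1) p(1) u(1)] Comp_assoc[OF w(1) qH(1) x] p w st(3) by simp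
    then have "p \<cdot> w = s" using monic_cancel[OF u(2,1)] Comp_Hom[OF w(1) p(1)] st by blast
    then show ?thesis using w by blast
  qed
  moreover have "w = w'" if "w \<in> Hom C e d" "w' \<in> Hom C e d" "q \<cdot> w = q \<cdot> w'" for e w w'
    using monic_cancel[OF kernel_monic[OF q] qH(1)] that by blast
  ultimately have pb: "\<exists>!w. w \<in> Hom C e d \<and> p \<cdot> w = s \<and> q \<cdot> w = t"
    if "s \<in> Hom C e a" "t \<in> Hom C e b" "u \<cdot> s = x \<cdot> t" for e s t
    using that by (metis (no_types, lifting))
  have "is_pullback C u x p q"
    unfolding is_pullback_def using HomD[OF u(1)] HomD[OF x] HomD[OF p(1)] p qH(1)
    using pb d_def by simp
  then show ?thesis using that kernel_monic[OF q] by blast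
qed

text \<open>
  The preimage of \<open>u\<close> under \<open>x\<close> is the largest restriction of \<open>x\<close> that factors through \<open>u\<close>, so
  it is nonzero iff some nonzero restriction does.  In this form essentiality can be used one test
  monomorphism after another, with no need to build the intersections in between.
\<close>

lemma essential_iff:
  assumes u: "u \<in> Hom C K L"
  shows "essential C u L \<longleftrightarrow> monic C u \<and>
    (\<forall>X. \<forall>x\<in>Hom C X L. monic C x \<longrightarrow> \<not> zero_object C X \<longrightarrow>
       (\<exists>A. \<exists>a\<in>Hom C A X. \<exists>b\<in>Hom C A K. monic C a \<and> \<not> zero_object C A \<and> x \<cdot> a = u \<cdot> b))"
    (is "_ \<longleftrightarrow> _ \<and> ?R")
proof
  assume ess: "essential C u L"
  then have mu: "monic C u" by (simp add: essential_def subobject_def)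
  have "?R"
  proof (intro allI ballI impI)
    fix X x assume x: "x \<in> Hom C X L" "monic C x" "\<not> zero_object C X"
    obtain p q where pq: "is_pullback C u x p q" "monic C q"
      using ex_pullback_of_monic[OF u mu x(1)] .
    then have "is_intersection C u x (u \<cdot> p)" unfolding is_intersection_def by blast
    then have "\<not> zero_object C (Dom C (u \<cdot> p))"
      using ess x unfolding essential_def subobject_def by (metis HomD(2,3))
    moreover have pqH: "p \<in> Hom C (Dom C p) K" "q \<in> Hom C (Dom C p) X" "x \<cdot> q = u \<cdot> p"
      using pq(1) HomD[OF u] HomD[OF x(1)] unfolding is_pullback_def by auto
    ultimately have "\<not> zero_object C (Dom C p)"
      using HomD[OF Comp_Hom[OF pqH(1) u]] by simp
    then show "\<exists>A. \<exists>a\<in>Hom C A X. \<exists>b\<in>Hom C A K. monic C a \<and> \<not> zero_object C A \<and> x \<cdot> a = u \<cdot> b"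
      using pqH pq(2) by blast
  qed
  with mu show "monic C u \<and> ?R" by blast
next
  assume R: "monic C u \<and> ?R"
  have "zero_object C (Dom C x)"
    if x: "subobject C x L" and m: "is_intersection C u x m" and z: "zero_object C (Dom C m)" for x m
  proof (rule ccontr)
    assume nz: "\<not> zero_object C (Dom C x)"
    have xH: "x \<in> Hom C (Dom C x) L" "monic C x"
      using x by (auto simp: subobject_def monic_def Hom_def)
    obtain A a b where ab: "a \<in> Hom C A (Dom C x)" "b \<in> Hom C A K" "monic C a"
      "\<not> zero_object C A" "x \<cdot> a = u \<cdot> b"
      using R xH nz by blast
    obtain p q where pq: "is_pullback C u x p q" "m = u \<cdot> p"
      using m unfolding is_intersection_def by blast
    have p: "p \<in> Hom C (Dom C p) K" and q: "q \<in> Hom C (Dom C p) (Dom C x)"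
      using pq(1) HomD[OF u] unfolding is_pullback_def by auto
    obtain w where w: "w \<in> Hom C A (Dom C p)" "q \<cdot> w = a"
      using pullback_factor[OF pq(1) u xH(1) ab(2,1)] ab(5) by metis
    have "Dom C m = Dom C p" using pq(2) HomD[OF Comp_Hom[OF p u]] by simp
    then show False
      using zero_object_monic[OF w(1)] monic_right_factor[OF w(1) q] w(2) ab z by metis
  qed
  then show "essential C u L"
    using R HomD[OF u] unfolding essential_def subobject_def by blast
qed

lemma essential_in_direct_summand_iff:
  assumes k: "k \<in> Hom C K M"
  shows "essential_in_direct_summand C k M \<longleftrightarrow> monic C k \<and>
    (\<exists>D. \<exists>d\<in>Hom C D M. \<exists>r\<in>Hom C M D. \<exists>u\<in>Hom C K D.
       r \<cdot> d = Ident C D \<and> d \<cdot> u = k \<and> essential C u D)" (is "_ \<longleftrightarrow> _ \<and> ?R")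
proof
  assume "essential_in_direct_summand C k M"
  then obtain d u where du: "direct_summand C d M" "u \<in> Hom C K (Dom C d)" "d \<cdot> u = k"
      "essential C u (Dom C d)" and "monic C k"
    unfolding essential_in_direct_summand_def subobject_def using HomD[OF k] by auto
  then show "monic C k \<and> ?R"
    using direct_summandE[OF du(1)] unfolding is_biproduct_def by metis
next
  assume "monic C k \<and> ?R"
  then obtain D d r u where R: "monic C k" "d \<in> Hom C D M" "r \<in> Hom C M D" "u \<in> Hom C K D"
       "r \<cdot> d = Ident C D" "d \<cdot> u = k" "essential C u D" by blast
  then show "essential_in_direct_summand C k M"
    unfolding essential_in_direct_summand_def subobject_def
    using direct_summand_if_split[OF R(2,3,5)] HomD[OF k] HomD[OF R(2)] by auto
qed


section \<open>The modular law and intersections of essential subobjects\<close>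

text \<open>
  This is the modular law for direct summands \<open>D\<close> and \<open>N\<close> of \<open>M\<close>, where \<open>N\<close> contains a
  complement of \<open>D\<close>: the projection onto \<open>D\<close> along \<open>D'\<close> maps \<open>N\<close> into itself, because it
  changes elements of \<open>N\<close> only by elements of \<open>D'\<close>.  Hence it maps \<open>N\<close> onto \<open>N \<inter> D\<close>, and its
  composite with the projection \<open>\<rho>\<close> onto \<open>N\<close> retracts \<open>M\<close> onto \<open>N \<inter> D\<close>.
\<close>

lemma ex_split_intersection_if_complement_le:
  assumes bi: "is_biproduct C D D' M d d' r r'"
    and nu: "\<nu> \<in> Hom C N M" and rho: "\<rho> \<in> Hom C M N" "\<rho> \<cdot> \<nu> = Ident C N"
    and b: "b \<in> Hom C D' N" "\<nu> \<cdot> b = d'"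
  obtains Y s t w where "is_pullback C d \<nu> s t" "s \<in> Hom C Y D" "t \<in> Hom C Y N"
    "w \<in> Hom C M Y" "w \<cdot> (d \<cdot> s) = Ident C Y"
proof -
  have d: "d \<in> Hom C D M" "d' \<in> Hom C D' M" "r \<in> Hom C M D" "r' \<in> Hom C M D'"
    "r \<cdot> d = Ident C D" "Plus C (d \<cdot> r) (d' \<cdot> r') = Ident C M"
    using bi by (auto simp: is_biproduct_def)
  have mnu: "monic C \<nu>" and md: "monic C d" using monic_split nu rho d by blast+
  obtain s t where st: "is_pullback C d \<nu> s t" "monic C t"
    using ex_pullback_of_monic[OF d(1) md nu] .
  define Y where "Y = Dom C s"
  have sH: "s \<in> Hom C Y D" and tH: "t \<in> Hom C Y N" and sq: "d \<cdot> s = \<nu> \<cdot> t"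
    using st(1) HomD[OF d(1)] HomD[OF nu] by (auto simp: is_pullback_def Y_def)
  have "d \<cdot> s \<in> Hom C Y M" by (rule Comp_Hom[OF sH d(1)])
  moreover have "monic C (d \<cdot> s)" using sq monic_Comp[OF tH st(2) nu mnu] by simp
  ultimately have ms: "monic C s" using monic_right_factor[OF sH d(1)] by blast
  \<comment> \<open>the components of \<open>\<nu>\<close> in \<open>D\<close> and in \<open>D'\<close>\<close>
  define x where "x = d \<cdot> (r \<cdot> \<nu>)"
  define x' where "x' = d' \<cdot> (r' \<cdot> \<nu>)"
  have rn: "r \<cdot> \<nu> \<in> Hom C N D" "r' \<cdot> \<nu> \<in> Hom C N D'" using Comp_Hom nu d by blast+
  have xH: "x \<in> Hom C N M" "x' \<in> Hom C N M"
    unfolding x_def x'_def using Comp_Hom rn d by blast+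
  have dec: "Plus C x x' = \<nu>"
    unfolding x_def x'_def
    using Comp_Plus_left[OF nu Comp_Hom[OF d(3,1)] Comp_Hom[OF d(4,2)]] d(6) Comp_Ident_left[OF nu]
      Comp_assoc[OF nu d(3,1)] Comp_assoc[OF nu d(4,2)] by simp
  \<comment> \<open>the idempotent \<open>\<nu> \<rho>\<close> fixes \<open>\<nu>\<close> and, because \<open>N\<close> contains the complement \<open>D'\<close>, also \<open>x'\<close>\<close>
  have nr: "\<nu> \<cdot> \<rho> \<in> Hom C M M" using Comp_Hom rho nu by blast
  have nrn: "(\<nu> \<cdot> \<rho>) \<cdot> \<nu> = \<nu>"
    using Comp_assoc[OF nu rho(1) nu] rho(2) Comp_Ident_right[OF nu] by simp
  have "(\<nu> \<cdot> \<rho>) \<cdot> d' = d'" using Comp_assoc[OF b(1) nu nr] nrn b(2) by simp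
  then have "(\<nu> \<cdot> \<rho>) \<cdot> x' = x'"
    unfolding x'_def using Comp_assoc[OF rn(2) d(2) nr] by simp
  then have "Plus C ((\<nu> \<cdot> \<rho>) \<cdot> x) x' = Plus C x x'"
    using Comp_Plus_right[OF xH nr] dec nrn by simp
  then have fix_x: "(\<nu> \<cdot> \<rho>) \<cdot> x = x"
    using Plus_right_cancel[OF xH(2) Comp_Hom[OF xH(1) nr] xH(1)] by blast
  then have "d \<cdot> (r \<cdot> \<nu>) = \<nu> \<cdot> (\<rho> \<cdot> x)"
    using Comp_assoc[OF xH(1) rho(1) nu] x_def by simp
  then obtain c where c: "c \<in> Hom C N Y" "s \<cdot> c = r \<cdot> \<nu>"
    using pullback_factor[OF st(1) d(1) nu rn(1) Comp_Hom[OF xH(1) rho(1)]] Y_def by metis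
  have w: "c \<cdot> \<rho> \<in> Hom C M Y" by (rule Comp_Hom[OF rho(1) c(1)])
  have ds: "d \<cdot> s \<in> Hom C Y M" by (rule Comp_Hom[OF sH d(1)])
  have "s \<cdot> ((c \<cdot> \<rho>) \<cdot> (d \<cdot> s)) = s \<cdot> Ident C Y"
  proof -
    have "\<rho> \<cdot> (d \<cdot> s) = t"
      using sq Comp_assoc[OF tH nu rho(1)] rho(2) Comp_Ident_left[OF tH] by simp
    then have "s \<cdot> ((c \<cdot> \<rho>) \<cdot> (d \<cdot> s)) = s \<cdot> (c \<cdot> t)"
      using Comp_assoc[OF ds rho(1) c(1)] by simp
    also have "\<dots> = r \<cdot> (\<nu> \<cdot> t)"
      using Comp_assoc[OF tH c(1) sH] c(2) Comp_assoc[OF tH nu d(3)] by simp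
    also have "\<dots> = s"
      using sq Comp_assoc[OF sH d(1) d(3)] d(5) Comp_Ident_left[OF sH] by simp
    finally show ?thesis using Comp_Ident_right[OF sH] by simp
  qed
  then have "(c \<cdot> \<rho>) \<cdot> (d \<cdot> s) = Ident C Y"
    using monic_cancel[OF ms sH] Comp_Hom[OF ds w] Ident_Hom Hom_Obj[OF sH] by blast
  then show ?thesis using that st(1) sH tH w by blast
qed

lemma essentialD:
  assumes "essential C u L" "u \<in> Hom C K L" "x \<in> Hom C X L" "monic C x" "\<not> zero_object C X"
  obtains A a b where "a \<in> Hom C A X" "b \<in> Hom C A K" "monic C a" "\<not> zero_object C A"
    "x \<cdot> a = u \<cdot> b"
  using assms unfolding essential_iff[OF assms(2)] by blast

text \<open>
  Over an intersection of ambient objects the intersection of essential subobjects is again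
  essential: a test monomorphism into \<open>D \<inter> F\<close> is first cut down to one that factors through
  \<open>K\<close>, and the result is cut down to one that factors through \<open>L\<close> as well.
\<close>

lemma essential_intersection:
  assumes d: "d \<in> Hom C D M" and f: "f \<in> Hom C F M"
    and u: "u \<in> Hom C K D" "essential C u D" and v: "v \<in> Hom C L F" "essential C v F"
    and pq: "is_pullback C (d \<cdot> u) (f \<cdot> v) p q"
    and x: "x1 \<in> Hom C A D" "x2 \<in> Hom C A F" "x = d \<cdot> x1" "x = f \<cdot> x2"
    and mx: "monic C x" and A: "\<not> zero_object C A"
  obtains B a c where "a \<in> Hom C B A" "c \<in> Hom C B (Dom C p)" "monic C a"
    "\<not> zero_object C B" "x \<cdot> a = (d \<cdot> u) \<cdot> (p \<cdot> c)"
proof -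
  have mx1: "monic C x1" using monic_right_factor[OF x(1) d] x(3) mx by simp
  have mx2: "monic C x2" using monic_right_factor[OF x(2) f] x(4) mx by simp
  obtain A1 a1 b1 where a1: "a1 \<in> Hom C A1 A" "b1 \<in> Hom C A1 K" "monic C a1"
      "\<not> zero_object C A1" "x1 \<cdot> a1 = u \<cdot> b1"
    using essentialD[OF u(2,1) x(1) mx1 A] .
  obtain A2 a2 b2 where a2: "a2 \<in> Hom C A2 A1" "b2 \<in> Hom C A2 L" "monic C a2"
      "\<not> zero_object C A2" "(x2 \<cdot> a1) \<cdot> a2 = v \<cdot> b2"
    using essentialD[OF v(2,1) Comp_Hom[OF a1(1) x(2)]
        monic_Comp[OF a1(1,3) x(2) mx2] a1(4)] .
  define a where "a = a1 \<cdot> a2"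
  have a: "a \<in> Hom C A2 A" "monic C a"
    unfolding a_def using Comp_Hom[OF a2(1) a1(1)] monic_Comp[OF a2(1,3) a1(1,3)] by auto
  have b12: "b1 \<cdot> a2 \<in> Hom C A2 K" by (rule Comp_Hom[OF a2(1) a1(2)])
  have "x1 \<cdot> a = u \<cdot> (b1 \<cdot> a2)"
    using Comp_assoc[OF a2(1) a1(1) x(1)] Comp_assoc[OF a2(1) a1(2) u(1)] a1(5) a_def by simp
  then have in_k: "x \<cdot> a = (d \<cdot> u) \<cdot> (b1 \<cdot> a2)"
    using x(3) Comp_assoc[OF a(1) x(1) d] Comp_assoc[OF b12 u(1) d] by simp
  have "x2 \<cdot> a = v \<cdot> b2"
    using Comp_assoc[OF a2(1) a1(1) x(2)] a2(5) a_def by simp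
  then have in_l: "x \<cdot> a = (f \<cdot> v) \<cdot> b2"
    using x(4) Comp_assoc[OF a(1) x(2) f] Comp_assoc[OF a2(2) v(1) f] by metis
  obtain c where "c \<in> Hom C A2 (Dom C p)" "p \<cdot> c = b1 \<cdot> a2"
    using pullback_factor[OF pq Comp_Hom[OF u(1) d] Comp_Hom[OF v(1) f] b12 a2(2)] in_k in_l
    by metis
  then show ?thesis using that a a2(4) in_k by metis
qed

text \<open>
  In the proof \<open>N\<close> is the direct summand that contains \<open>Ker g\<close> essentially, and
  \<open>y : Y \<rightarrow> M\<close> is \<open>N \<inter> D\<close>.
\<close>

theorem self_CS_Rickart_SIP_extending:
  assumes "self_CS_Rickart C M"
  shows "SIP_extending C M"
  unfolding SIP_extending_def
proof (intro conjI allI impI)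
  show "M \<in> Obj C" using assms by (simp add: self_CS_Rickart_def)
  fix k l m
  assume k: "essential_in_direct_summand C k M" and l: "essential_in_direct_summand C l M"
    and m: "is_intersection C k l m"
  obtain p q where pq: "is_pullback C k l p q" and mp: "m = k \<cdot> p"
    using m unfolding is_intersection_def by blast
  define K where "K = Dom C k"
  define L where "L = Dom C l"
  define P where "P = Dom C p"
  have mk: "monic C k" "monic C l" and "Cod C k = M" "Cod C l = M"
    using k l by (auto simp: essential_in_direct_summand_def subobject_def)
  then have kH: "k \<in> Hom C K M" and lH: "l \<in> Hom C L M"
    by (auto simp: monic_def K_def L_def Hom_def)
  have pH: "p \<in> Hom C P K" and qH: "q \<in> Hom C P L" and mq: "m = l \<cdot> q"
    using pq mp by (auto simp: is_pullback_def P_def K_def L_def)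
  have mH: "m \<in> Hom C P M" using mp Comp_Hom[OF pH kH] by simp
  obtain d u where du: "direct_summand C d M" "u \<in> Hom C K (Dom C d)" "d \<cdot> u = k"
      "essential C u (Dom C d)"
    using k unfolding essential_in_direct_summand_def K_def by blast
  obtain D2 d2 r r2 where bi: "is_biproduct C (Dom C d) D2 M d d2 r r2"
    using direct_summandE[OF du(1)] .
  define D where "D = Dom C d"
  have d: "d \<in> Hom C D M" "d2 \<in> Hom C D2 M" "r \<in> Hom C M D" "r2 \<in> Hom C M D2"
    "r \<cdot> d = Ident C D" "r \<cdot> d2 = Null C D2 D" and uH: "u \<in> Hom C K D"
    using bi du(2) by (auto simp: is_biproduct_def D_def)
  obtain f v where fv: "direct_summand C f M" "v \<in> Hom C L (Dom C f)" "f \<cdot> v = l"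
      "essential C v (Dom C f)"
    using l unfolding essential_in_direct_summand_def L_def by blast
  obtain F2 f2 e e2 where bi': "is_biproduct C (Dom C f) F2 M f f2 e e2"
    using direct_summandE[OF fv(1)] .
  define F where "F = Dom C f"
  have f: "f \<in> Hom C F M" "f2 \<in> Hom C F2 M" "e \<in> Hom C M F" "e2 \<in> Hom C M F2"
    "e \<cdot> f = Ident C F" "e2 \<cdot> f = Null C F F2" "e2 \<cdot> f2 = Ident C F2"
    "Plus C (f \<cdot> e) (f2 \<cdot> e2) = Ident C M" and vH: "v \<in> Hom C L F"
    using bi' fv(2) by (auto simp: is_biproduct_def F_def)
  have obj: "M \<in> Obj C" "D \<in> Obj C" "D2 \<in> Obj C" "F \<in> Obj C" "F2 \<in> Obj C"
    using Hom_Obj d f by blast+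
  \<comment> \<open>the endomorphism with kernel \<open>(D \<inter> F) \<oplus> D'\<close>, where \<open>D'\<close> and \<open>F'\<close> are the complements\<close>
  define g where "g = (f2 \<cdot> e2) \<cdot> (d \<cdot> r)"
  have fe: "f2 \<cdot> e2 \<in> Hom C M M" and dr: "d \<cdot> r \<in> Hom C M M" using Comp_Hom d f by blast+
  have gH: "g \<in> Hom C M M" unfolding g_def by (rule Comp_Hom[OF dr fe])
  obtain \<kappa> where kap: "is_kernel C g \<kappa>" using ex_kernel HomD[OF gH] by blast
  define G where "G = Dom C \<kappa>"
  note kapH = kernelD[OF kap gH, folded G_def]
  have "essential_in_direct_summand C \<kappa> M"
    using assms gH kap unfolding self_CS_Rickart_def by blast
  then obtain N \<nu> \<rho> h where N: "\<nu> \<in> Hom C N M" "\<rho> \<in> Hom C M N" "\<rho> \<cdot> \<nu> = Ident C N"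
      "h \<in> Hom C G N" "\<nu> \<cdot> h = \<kappa>" "essential C h N"
    unfolding essential_in_direct_summand_iff[OF kapH(1)] by blast
  \<comment> \<open>the complement of \<open>D\<close> lies in \<open>Ker g\<close>, hence in \<open>N\<close>\<close>
  have "g \<cdot> d2 = Null C D2 M"
    unfolding g_def
    using Comp_assoc[OF d(2) dr fe] Comp_assoc[OF d(2) d(3) d(1)] d(6)
      Comp_Null_right[OF d(1) obj(3)] Comp_Null_right[OF fe obj(3)] by simp
  then obtain b0 where b0: "b0 \<in> Hom C D2 G" "\<kappa> \<cdot> b0 = d2"
    using kernel_factor[OF kap gH d(2)] G_def by metis
  have b: "h \<cdot> b0 \<in> Hom C D2 N" "\<nu> \<cdot> (h \<cdot> b0) = d2"
    using Comp_Hom[OF b0(1) N(4)] Comp_assoc[OF b0(1) N(4) N(1)] N(5) b0(2) by auto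
  obtain Y s t w where Y: "is_pullback C d \<nu> s t" "s \<in> Hom C Y D" "t \<in> Hom C Y N"
    "w \<in> Hom C M Y" "w \<cdot> (d \<cdot> s) = Ident C Y"
    using ex_split_intersection_if_complement_le[OF bi[folded D_def] N(1-3) b] .
  define y where "y = d \<cdot> s"
  have yH: "y \<in> Hom C Y M" unfolding y_def by (rule Comp_Hom[OF Y(2) d(1)])
  have yt: "y = \<nu> \<cdot> t" using Y(1) by (simp add: is_pullback_def y_def)
  have my: "monic C y" using monic_split[OF yH Y(4)] Y(5) y_def by simp
  have g_on_D: "g \<cdot> (d \<cdot> c) = (f2 \<cdot> e2) \<cdot> (d \<cdot> c)" if c: "c \<in> Hom C A D" for A c
  proof -
    have "(d \<cdot> r) \<cdot> (d \<cdot> c) = d \<cdot> c"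
      using Comp_assoc[OF Comp_Hom[OF c d(1)] d(3) d(1)] Comp_assoc[OF c d(1) d(3)] d(5)
        Comp_Ident_left[OF c] by simp
    then show ?thesis
      unfolding g_def using Comp_assoc[OF Comp_Hom[OF c d(1)] dr fe] by simp
  qed
  have m_du: "m = d \<cdot> (u \<cdot> p)" using mp du(3) Comp_assoc[OF pH uH d(1)] by simp
  have m_fv: "m = f \<cdot> (v \<cdot> q)" using mq fv(3) Comp_assoc[OF qH vH f(1)] by simp
  \<comment> \<open>\<open>m\<close> factors through \<open>D\<close> and through \<open>N\<close>, hence through \<open>Y\<close>\<close>
  have "(f2 \<cdot> e2) \<cdot> m = Null C P M"
  proof -
    have vq: "v \<cdot> q \<in> Hom C P F" by (rule Comp_Hom[OF qH vH])
    show ?thesis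
      using Comp_assoc[OF mH f(4) f(2)] Comp_assoc[OF vq f(1) f(4)] m_fv f(6)
        Comp_Null_left[OF vq obj(5)] Comp_Null_right[OF f(2) Hom_Obj(1)[OF mH]] by simp
  qed
  then have "g \<cdot> m = Null C P M" using g_on_D[OF Comp_Hom[OF pH uH]] m_du by simp
  then obtain c0 where c0: "c0 \<in> Hom C P G" "\<kappa> \<cdot> c0 = m"
    using kernel_factor[OF kap gH mH] G_def by metis
  have "d \<cdot> (u \<cdot> p) = \<nu> \<cdot> (h \<cdot> c0)" using m_du c0(2) N(5) Comp_assoc[OF c0(1) N(4,1)] by simp
  then obtain z where z: "z \<in> Hom C P Y" "s \<cdot> z = u \<cdot> p"
    using pullback_factor[OF Y(1) d(1) N(1) Comp_Hom[OF pH uH] Comp_Hom[OF c0(1) N(4)]]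
      HomD[OF Y(2)] by metis
  have yz: "y \<cdot> z = m" using Comp_assoc[OF z(1) Y(2) d(1)] z(2) m_du y_def by simp
  have mm: "monic C m" unfolding mp by (rule pullback_monic[OF pq mk(1) kH mk(2) lH])
  have mz: "monic C z" using monic_right_factor[OF z(1) yH] yz mm by simp
  have "essential C z Y"
    unfolding essential_iff[OF z(1)]
  proof (intro conjI mz allI ballI impI)
    fix X x assume x: "x \<in> Hom C X Y" "monic C x" "\<not> zero_object C X"
    have mt: "monic C t" using monic_right_factor[OF Y(3) N(1)] yt my by simp
    \<comment> \<open>restrict \<open>x\<close> so that it lands in \<open>Ker g\<close>, then so that it lands in \<open>K \<inter> L\<close>\<close>
    obtain A a b where a: "a \<in> Hom C A X" "b \<in> Hom C A G" "monic C a" "\<not> zero_object C A"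
      "(t \<cdot> x) \<cdot> a = h \<cdot> b"
      using essentialD[OF N(6,4) Comp_Hom[OF x(1) Y(3)] monic_Comp[OF x(1,2) Y(3) mt] x(3)] .
    define x1 where "x1 = x \<cdot> a"
    have x1: "x1 \<in> Hom C A Y" "monic C x1"
      unfolding x1_def using Comp_Hom[OF a(1) x(1)] monic_Comp[OF a(1,3) x(1,2)] by auto
    have ms: "monic C s" using monic_right_factor[OF Y(2) d(1)] my y_def by simp
    have sx1: "s \<cdot> x1 \<in> Hom C A D" "monic C (s \<cdot> x1)"
      using Comp_Hom[OF x1(1) Y(2)] monic_Comp[OF x1 Y(2) ms] by auto
    have yx1: "y \<cdot> x1 = d \<cdot> (s \<cdot> x1)" "y \<cdot> x1 \<in> Hom C A M" "monic C (y \<cdot> x1)"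
      using Comp_assoc[OF x1(1) Y(2) d(1)] y_def Comp_Hom[OF x1(1) yH] monic_Comp[OF x1 yH my]
      by auto
    have "y \<cdot> x1 = \<kappa> \<cdot> b"
      using yt Comp_assoc[OF x1(1) Y(3) N(1)] Comp_assoc[OF a(1) x(1) Y(3)] a(5)
        Comp_assoc[OF a(2) N(4,1)] N(5) x1_def by simp
    then have "g \<cdot> (y \<cdot> x1) = Null C A M"
      using Comp_assoc[OF a(2) kapH(1) gH] kapH(2) Comp_Null_left[OF a(2) obj(1)] by simp
    \<comment> \<open>on \<open>D\<close> the endomorphism \<open>g\<close> is the projection along \<open>F\<close>, so \<open>y x1\<close> lands in \<open>F\<close>\<close>
    then have "(f2 \<cdot> e2) \<cdot> (y \<cdot> x1) = Null C A M"
      using g_on_D[OF sx1(1)] yx1(1) by simp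
    then have "f \<cdot> (e \<cdot> (y \<cdot> x1)) = y \<cdot> x1"
      using Comp_Plus_left[OF yx1(2) Comp_Hom[OF f(3,1)] fe] f(8) Comp_Ident_left[OF yx1(2)]
        Plus_Null_right[OF Comp_Hom[OF yx1(2) Comp_Hom[OF f(3,1)]]]
        Comp_assoc[OF yx1(2) f(3,1)] by simp
    then obtain x2 where x2: "x2 \<in> Hom C A F" "f \<cdot> x2 = y \<cdot> x1"
      using Comp_Hom[OF yx1(2) f(3)] by blast
    obtain B a' c where c: "a' \<in> Hom C B A" "c \<in> Hom C B P" "monic C a'"
        "\<not> zero_object C B" "(y \<cdot> x1) \<cdot> a' = k \<cdot> (p \<cdot> c)"
      using essential_intersection[OF d(1) f(1) uH du(4)[folded D_def] vH fv(4)[folded F_def],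
          unfolded du(3) fv(3), OF pq, folded P_def, OF sx1(1) x2(1) yx1(1) x2(2)[symmetric]
          yx1(3) a(4)] .
    have zc: "z \<cdot> c \<in> Hom C B Y" and x1a: "x1 \<cdot> a' \<in> Hom C B Y"
      using Comp_Hom[OF c(2) z(1)] Comp_Hom[OF c(1) x1(1)] by auto
    have "y \<cdot> (x1 \<cdot> a') = y \<cdot> (z \<cdot> c)"
      using Comp_assoc[OF c(1) x1(1) yH] c(5) Comp_assoc[OF c(2) pH kH] mp yz
        Comp_assoc[OF c(2) z(1) yH] by simp
    then have "x1 \<cdot> a' = z \<cdot> c" using monic_cancel[OF my yH x1a zc] by blast
    then have "x \<cdot> (a \<cdot> a') = z \<cdot> c"
      using Comp_assoc[OF c(1) a(1) x(1)] x1_def by simp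
    then show "\<exists>A. \<exists>a\<in>Hom C A X. \<exists>b\<in>Hom C A P. monic C a \<and> \<not> zero_object C A \<and> x \<cdot> a = z \<cdot> b"
      using Comp_Hom[OF c(1) a(1)] monic_Comp[OF c(1,3) a(1,3)] c(2,4) by blast
  qed
  then show "essential_in_direct_summand C m M"
    unfolding essential_in_direct_summand_iff[OF mH]
    using mm yH Y(4,5) z(1) yz y_def by blast
qed

section \<open>Duality for lifting and superfluity\<close>

text \<open>
  An arrow out of \<open>M\<close> kills \<open>K + L\<close> iff it kills \<open>K\<close> and \<open>L\<close>, that is, iff it factors through
  both \<open>M/K\<close> and \<open>M/L\<close>; so \<open>M/(K + L)\<close> is the pushout of \<open>M/K\<close> and \<open>M/L\<close>.
\<close>

lemma is_intersection_opposite_cokernels_of_sum: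
  assumes k: "k \<in> Hom C K M" and l: "l \<in> Hom C L M"
    and co: "is_coproduct C K L i j"
    and h: "h \<in> Hom C (Cod C i) M" "h \<cdot> i = k" "h \<cdot> j = l"
    and c: "is_cokernel C k c" and c': "is_cokernel C l c'" and q: "is_cokernel C h q"
  shows "is_intersection (opposite C) c c' q"
proof -
  have iH: "i \<in> Hom C K (Cod C i)" and jH: "j \<in> Hom C L (Cod C i)"
    using co by (auto simp: is_coproduct_def)
  define Q where "Q = Cod C q"
  note cH = cokernelD[OF c k] and cH' = cokernelD[OF c' l] and qH = cokernelD[OF q h(1), folded Q_def]
  have obj: "K \<in> Obj C" "L \<in> Obj C" "M \<in> Obj C" "Q \<in> Obj C" "Cod C i \<in> Obj C"
    using Hom_Obj k l qH h(1) by blast+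
  have "q \<cdot> k = Null C K Q"
    using h(2) Comp_assoc[OF iH h(1) qH(1)] qH(2) Comp_Null_left[OF iH obj(4)] by simp
  then obtain p where p: "p \<in> Hom C (Cod C c) Q" "p \<cdot> c = q"
    using cokernel_factor[OF c k qH(1)] by metis
  have "q \<cdot> l = Null C L Q"
    using h(3) Comp_assoc[OF jH h(1) qH(1)] qH(2) Comp_Null_left[OF jH obj(4)] by simp
  then obtain p' where p': "p' \<in> Hom C (Cod C c') Q" "p' \<cdot> c' = q"
    using cokernel_factor[OF c' l qH(1)] by metis
  have mq: "epic C q" by (rule cokernel_epic[OF q])
  then have ep: "epic C p" "epic C p'"
    using epic_left_factor[OF cH(1) p(1)] epic_left_factor[OF cH'(1) p'(1)] p p' by auto
  have "\<exists>!w. w \<in> Hom C Q e \<and> w \<cdot> p = a \<and> w \<cdot> p' = b"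
    if ab: "a \<in> Hom C (Cod C c) e" "b \<in> Hom C (Cod C c') e" "a \<cdot> c = b \<cdot> c'" for e a b
  proof -
    define z where "z = a \<cdot> c"
    have zH: "z \<in> Hom C M e" unfolding z_def by (rule Comp_Hom[OF cH(1) ab(1)])
    have e: "e \<in> Obj C" using Hom_Obj ab by blast
    have zh: "z \<cdot> h \<in> Hom C (Cod C i) e" by (rule Comp_Hom[OF h(1) zH])
    have N: "Null C (Cod C i) e \<in> Hom C (Cod C i) e" "Null C K e \<in> Hom C K e"
      "Null C L e \<in> Hom C L e" using Null_Hom obj e by blast+
    have "z \<cdot> k = Null C K e"
      using z_def Comp_assoc[OF k cH(1) ab(1)] cH(2) Comp_Null_right[OF ab(1) obj(1)] by simp
    then have zi: "(z \<cdot> h) \<cdot> i = Null C K e" using Comp_assoc[OF iH h(1) zH] h(2) by simp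
    have "z \<cdot> l = Null C L e"
      using z_def ab(3) Comp_assoc[OF l cH'(1) ab(2)] cH'(2) Comp_Null_right[OF ab(2) obj(2)] by simp
    then have zj: "(z \<cdot> h) \<cdot> j = Null C L e" using Comp_assoc[OF jH h(1) zH] h(3) by simp
    have "\<exists>!x. x \<in> Hom C (Cod C i) e \<and> x \<cdot> i = Null C K e \<and> x \<cdot> j = Null C L e"
      using co e N unfolding is_coproduct_def by blast
    then have "z \<cdot> h = Null C (Cod C i) e"
      using zi zj zh N(1) Comp_Null_left[OF iH e] Comp_Null_left[OF jH e] by blast
    then obtain w where w: "w \<in> Hom C Q e" "w \<cdot> q = z"
      using cokernel_factor[OF q h(1) zH] Q_def by metis
    have "w \<cdot> p = a"
    proof (rule epic_cancel[OF cokernel_epic[OF c] cH(1) Comp_Hom[OF p(1) w(1)] ab(1)])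
      show "(w \<cdot> p) \<cdot> c = a \<cdot> c" using Comp_assoc[OF cH(1) p(1) w(1)] p(2) w(2) z_def by simp
    qed
    moreover have "w \<cdot> p' = b"
    proof (rule epic_cancel[OF cokernel_epic[OF c'] cH'(1) Comp_Hom[OF p'(1) w(1)] ab(2)])
      show "(w \<cdot> p') \<cdot> c' = b \<cdot> c'"
        using Comp_assoc[OF cH'(1) p'(1) w(1)] p'(2) w(2) z_def ab(3) by simp
    qed
    moreover have "w' = w" if "w' \<in> Hom C Q e" "w' \<cdot> p = a" for w'
      using epic_cancel[OF ep(1) p(1) that(1) w(1)] that(2) \<open>w \<cdot> p = a\<close> by simp
    ultimately show ?thesis using w(1) by blast
  qed
  then have "is_pullback (opposite C) c c' p p'"
    unfolding is_pullback_def using p p' HomD[OF cH(1)] HomD[OF cH'(1)] HomD[OF p(1)] HomD[OF p'(1)]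
    by simp
  then show ?thesis unfolding is_intersection_def using p(2) by auto
qed

lemma biproduct_coproduct:
  assumes "is_biproduct C a b c i j p q"
  shows "is_coproduct C a b i j"
proof -
  have H: "i \<in> Hom C a c" "j \<in> Hom C b c" "p \<in> Hom C c a" "q \<in> Hom C c b"
    "p \<cdot> i = Ident C a" "q \<cdot> j = Ident C b" "p \<cdot> j = Null C b a" "q \<cdot> i = Null C a b"
    "Plus C (i \<cdot> p) (j \<cdot> q) = Ident C c"
    using assms by (auto simp: is_biproduct_def)
  have "\<exists>!x. x \<in> Hom C c e \<and> x \<cdot> i = s \<and> x \<cdot> j = t"
    if st: "s \<in> Hom C a e" "t \<in> Hom C b e" for e s t
  proof -
    have sp: "s \<cdot> p \<in> Hom C c e" "t \<cdot> q \<in> Hom C c e" using Comp_Hom H st by blast+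
    have 1: "Plus C (s \<cdot> p) (t \<cdot> q) \<cdot> i = s"
      using Comp_Plus_left[OF H(1) sp] Comp_assoc[OF H(1,3) st(1)] Comp_assoc[OF H(1,4) st(2)]
        H(5,8) Comp_Ident_right[OF st(1)] Comp_Null_right[OF st(2) Hom_Obj(1)[OF H(1)]]
        Plus_Null_right[OF st(1)] by simp
    have 2: "Plus C (s \<cdot> p) (t \<cdot> q) \<cdot> j = t"
      using Comp_Plus_left[OF H(2) sp] Comp_assoc[OF H(2,3) st(1)] Comp_assoc[OF H(2,4) st(2)]
        H(6,7) Comp_Ident_right[OF st(2)] Comp_Null_right[OF st(1) Hom_Obj(1)[OF H(2)]]
        Plus_Null_left[OF st(2)] by simp
    have 3: "x = Plus C (s \<cdot> p) (t \<cdot> q)"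
      if x: "x \<in> Hom C c e" "x \<cdot> i = s" "x \<cdot> j = t" for x
    proof -
      have "x = x \<cdot> Plus C (i \<cdot> p) (j \<cdot> q)" using H(9) Comp_Ident_right[OF x(1)] by simp
      also have "\<dots> = Plus C (x \<cdot> (i \<cdot> p)) (x \<cdot> (j \<cdot> q))"
        by (rule Comp_Plus_right[OF Comp_Hom[OF H(3,1)] Comp_Hom[OF H(4,2)] x(1)])
      also have "\<dots> = Plus C (s \<cdot> p) (t \<cdot> q)"
        unfolding Comp_assoc[OF H(3,1) x(1), symmetric] Comp_assoc[OF H(4,2) x(1), symmetric] x(2,3) ..
      finally show ?thesis .
    qed
    show ?thesis
      by (rule ex1I[of _ "Plus C (s \<cdot> p) (t \<cdot> q)"])
        (use 1 2 Plus_Hom[OF sp] in simp, elim conjE, rule 3)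
  qed
  then show ?thesis unfolding is_coproduct_def using H(1,2) HomD[OF H(1)] by simp
qed

text \<open>
  A subobject is everything iff its cokernel is \<open>0\<close>.  Thus, under \<open>X \<mapsto> L/X\<close>, the condition
  that \<open>K + X = L\<close> implies \<open>X = L\<close> says that if the pushout of \<open>L/K\<close> and \<open>L/X\<close> is \<open>0\<close> then so
  is \<open>L/X\<close>.
\<close>

lemma superfluous_iff_essential_cokernel:
  assumes v: "v \<in> Hom C K L" "monic C v" and c: "is_cokernel C v c"
  shows "superfluous C v L \<longleftrightarrow> essential (opposite C) c L"
proof
  note cH = cokernelD[OF c v(1)]
  assume ess: "essential (opposite C) c L"
  have "invertible_arr C x"
    if x: "subobject C x L" and s: "is_sum C v x s" "invertible_arr C s" for x s
  proof -
    have xH: "x \<in> Hom C (Dom C x) L" "monic C x"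
      using x by (auto simp: subobject_def monic_def Hom_def)
    obtain d where d: "is_cokernel C x d" using ex_cokernel HomD[OF xH(1)] by blast
    note dH = cokernelD[OF d xH(1)]
    obtain i j h q where h: "is_coproduct C K (Dom C x) i j" "h \<in> Hom C (Cod C i) L"
      "h \<cdot> i = v" "h \<cdot> j = x" "is_cokernel C h q" "is_kernel C q s"
      using s(1) HomD[OF v(1)] unfolding is_sum_def is_image_def by blast
    note qH = cokernelD[OF h(5,2)]
    have "zero_object C (Cod C q)"
      using invertible_iff_cokernel_zero[OF kernelD(1)[OF h(6) qH(1)] kernel_monic[OF h(6)]
        epic_cokernel_of_kernel[OF cokernel_epic[OF h(5)] h(6)]] s(2) by blast
    then have "zero_object C (Cod C d)"
      using ess is_intersection_opposite_cokernels_of_sum[OF v(1) xH(1) h(1-4) c d h(5)]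
        cokernel_epic[OF d] HomD[OF dH(1)] unfolding essential_def subobject_def by auto
    then show ?thesis using invertible_iff_cokernel_zero[OF xH d] by blast
  qed
  then show "superfluous C v L"
    unfolding superfluous_def subobject_def using v HomD[OF v(1)] by blast
next
  note cH = cokernelD[OF c v(1)]
  assume sup: "superfluous C v L"
  have "zero_object C (Cod C x)"
    if x: "epic C x" "Dom C x = L" and m: "is_intersection (opposite C) c x m"
      and z: "zero_object C (Cod C m)" for x m
  proof -
    have xH: "x \<in> Hom C L (Cod C x)" using x by (auto simp: epic_def Hom_def)
    obtain y where y: "is_kernel C x y" using ex_kernel HomD[OF xH] by blast
    note yH = kernelD[OF y xH]
    have xy: "is_cokernel C y x" by (rule epic_cokernel_of_kernel[OF x(1) y])
    obtain e i j p q where bi: "is_biproduct C K (Dom C y) e i j p q"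
      using ex_biproduct Hom_Obj(1)[OF v(1)] Hom_Obj(1)[OF yH(1)] by blast
    note co = biproduct_coproduct[OF bi]
    obtain h where h: "h \<in> Hom C (Cod C i) L" "h \<cdot> i = v" "h \<cdot> j = y"
      using co v(1) yH(1) Hom_Obj(2)[OF v(1)] unfolding is_coproduct_def by blast
    obtain w where w: "is_cokernel C h w" using ex_cokernel HomD[OF h(1)] by blast
    note wH = cokernelD[OF w h(1)]
    obtain s where s: "is_kernel C w s" using ex_kernel HomD[OF wH(1)] by blast
    have "is_intersection (opposite C) c x w"
      by (rule is_intersection_opposite_cokernels_of_sum[OF v(1) yH(1) co h c xy w])
    then obtain a b where ab0: "is_pullback (opposite C) c x a b" "w = a \<cdot> c"
      unfolding is_intersection_def by auto
    have "a \<in> Hom C (Cod C c) (Cod C a)" "b \<in> Hom C (Cod C x) (Cod C a)" "a \<cdot> c = b \<cdot> x"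
      using ab0(1) by (auto simp: is_pullback_def)
    moreover from this(1) have "Cod C w = Cod C a"
      using ab0(2) HomD[OF Comp_Hom[OF cH(1)]] by simp
    ultimately have ab: "a \<in> Hom C (Cod C c) (Cod C w)" "b \<in> Hom C (Cod C x) (Cod C w)"
        "a \<cdot> c = b \<cdot> x" "w = a \<cdot> c"
      using ab0(2) by auto
    obtain p' q' where pq: "is_pullback (opposite C) c x p' q'" "m = p' \<cdot> c"
      using m unfolding is_intersection_def by auto
    interpret op: abelian_category "opposite C" by (rule abelian_opposite)
    have p': "p' \<in> Hom C (Cod C c) (Cod C p')" using pq(1) by (simp add: is_pullback_def)
    have mc: "Cod C m = Cod C p'" using pq(2) HomD[OF Comp_Hom[OF cH(1) p']] by simp
    \<comment> \<open>\<open>w\<close> factors through the given pushout \<open>m\<close>, which is \<open>0\<close>\<close>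
    obtain o' where o: "o' \<in> Hom C (Cod C p') (Cod C w)" "o' \<cdot> p' = a"
      using op.pullback_factor[OF pq(1), of "Cod C c" L "Cod C x" a "Cod C w" b] cH(1) xH ab
      by auto
    have mH: "m \<in> Hom C L (Cod C m)" using Comp_Hom[OF cH(1) p'] pq(2) mc by simp
    have "w = o' \<cdot> m" using o ab(4) pq(2) Comp_assoc[OF cH(1) p' o(1)] by simp
    moreover have "m = Null C L (Cod C m)" using zero_object_Hom(1)[OF z mH] .
    ultimately have "w = Null C L (Cod C w)"
      using Comp_Null_right[OF o(1) Hom_Obj(1)[OF mH]] mc by metis
    then have "zero_object C (Cod C w)"
      using epic_Null_zero_object cokernel_epic[OF w] Hom_Obj[OF wH(1)] by metis
    then have "invertible_arr C s"
      using invertible_iff_cokernel_zero[OF kernelD(1)[OF s wH(1)] kernel_monic[OF s]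
        epic_cokernel_of_kernel[OF cokernel_epic[OF w] s]] by blast
    moreover have "is_sum C v y s"
      unfolding is_sum_def is_image_def
      using co h w s HomD[OF v(1)] HomD[OF yH(1)] by auto
    ultimately have "invertible_arr C y"
      using sup kernel_monic[OF y] HomD[OF yH(1)] unfolding superfluous_def subobject_def by blast
    then show ?thesis using invertible_iff_cokernel_zero[OF yH(1) kernel_monic[OF y] xy] by blast
  qed
  then show "essential (opposite C) c L"
    unfolding essential_def subobject_def using cokernel_epic[OF c] HomD[OF cH(1)] by auto
qed

text \<open>
  Let \<open>q : M \<rightarrow> M/K\<close> be the quotient by a direct summand \<open>K\<close> inside \<open>L\<close>.  It splits, and \<open>c\<close>
  factors through it as \<open>c = c' q\<close>, where \<open>c' : M/K \<rightarrow> M/L\<close> is the cokernel of \<open>L/K \<rightarrow> M/K\<close>.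
\<close>

lemma cokernel_essential_if_lies_above:
  assumes l: "l \<in> Hom C L M" "monic C l" and c: "is_cokernel C l c"
    and above: "lies_above_direct_summand C l M"
  shows "essential_in_direct_summand (opposite C) c M"
proof -
  interpret op: abelian_category "opposite C" by (rule abelian_opposite)
  define Q where "Q = Cod C c"
  note cH = cokernelD[OF c l(1), folded Q_def]
  obtain k u q r v where a: "direct_summand C k M" "u \<in> Hom C (Dom C k) L" "l \<cdot> u = k"
    "is_cokernel C k q" "is_cokernel C u r" "v \<in> Hom C (Cod C r) (Cod C q)" "v \<cdot> r = q \<cdot> l"
    "superfluous C v (Cod C q)"
    using above HomD[OF l(1)] unfolding lies_above_direct_summand_def by auto
  obtain K' k' p p' where bi: "is_biproduct C (Dom C k) K' M k k' p p'"
    using direct_summandE[OF a(1)] .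
  define K where "K = Dom C k"
  define D where "D = Cod C q"
  have k: "k \<in> Hom C K M" "k' \<in> Hom C K' M" "p \<in> Hom C M K" "p' \<in> Hom C M K'"
    "p' \<cdot> k = Null C K K'" "Plus C (k \<cdot> p) (k' \<cdot> p') = Ident C M" and uH: "u \<in> Hom C K L"
    using bi a(2) by (auto simp: is_biproduct_def K_def)
  note qH = cokernelD[OF a(4) k(1), folded D_def] and rH = cokernelD[OF a(5) uH]
  have obj: "K \<in> Obj C" "M \<in> Obj C" "D \<in> Obj C" "Q \<in> Obj C" "L \<in> Obj C"
    using Hom_Obj k qH cH l by blast+
  \<comment> \<open>\<open>M/K\<close> is isomorphic to the complement \<open>K'\<close>, whose inclusion is therefore a section of \<open>q\<close>\<close>
  obtain w where w: "w \<in> Hom C D K'" "w \<cdot> q = p'"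
    using cokernel_factor[OF a(4) k(1) k(4,5)] unfolding D_def .
  have sec: "k' \<cdot> w \<in> Hom C D M" "q \<cdot> (k' \<cdot> w) = Ident C D"
  proof -
    show kw: "k' \<cdot> w \<in> Hom C D M" by (rule Comp_Hom[OF w(1) k(2)])
    have "q \<cdot> (k \<cdot> p) = Null C M D"
      using Comp_assoc[OF k(3,1) qH(1)] qH(2) Comp_Null_left[OF k(3) obj(3)] by simp
    then have "q \<cdot> (k' \<cdot> p') = q"
      using Comp_Plus_right[OF Comp_Hom[OF k(3,1)] Comp_Hom[OF k(4,2)] qH(1)] k(6)
        Comp_Ident_right[OF qH(1)] Plus_Null_left[OF Comp_Hom[OF Comp_Hom[OF k(4,2)] qH(1)]]
      by simp
    then have "(q \<cdot> (k' \<cdot> w)) \<cdot> q = Ident C D \<cdot> q"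
      using Comp_assoc[OF qH(1) kw qH(1)] Comp_assoc[OF qH(1) w(1) k(2)] w(2)
        Comp_Ident_left[OF qH(1)] by simp
    then show "q \<cdot> (k' \<cdot> w) = Ident C D"
      using epic_cancel[OF cokernel_epic[OF a(4)] qH(1) Comp_Hom[OF kw qH(1)] Ident_Hom[OF obj(3)]]
      by blast
  qed
  have "c \<cdot> k = Null C K Q"
    using a(3) Comp_assoc[OF uH l(1) cH(1)] cH(2) Comp_Null_left[OF uH obj(4)] by simp
  then obtain c' where c': "c' \<in> Hom C D Q" "c' \<cdot> q = c"
    using cokernel_factor[OF a(4) k(1) cH(1)] D_def by metis
  have vH: "v \<in> Hom C (Cod C r) D" using a(6) D_def by simp
  have "is_cokernel C v c'"
  proof (rule is_cokernelI[OF vH c'(1)])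
    show "epic C c'" using epic_left_factor[OF qH(1) c'(1)] c'(2) cokernel_epic[OF c] by simp
    have N: "Null C (Cod C r) Q \<in> Hom C (Cod C r) Q"
      using Null_Hom Hom_Obj rH obj by blast
    show "c' \<cdot> v = Null C (Cod C r) Q"
    proof (rule epic_cancel[OF cokernel_epic[OF a(5)] rH(1) Comp_Hom[OF vH c'(1)] N])
      show "(c' \<cdot> v) \<cdot> r = Null C (Cod C r) Q \<cdot> r"
        using Comp_assoc[OF rH(1) vH c'(1)] a(7) Comp_assoc[OF l(1) qH(1) c'(1)] c'(2) cH(2)
          Comp_Null_left[OF rH(1) obj(4)] by simp
    qed
    fix e g assume g: "g \<in> Hom C D e" "g \<cdot> v = Null C (Cod C r) e"
    have e: "e \<in> Obj C" using Hom_Obj g by blast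
    have "(g \<cdot> q) \<cdot> l = Null C L e"
      using Comp_assoc[OF l(1) qH(1) g(1)] a(7) Comp_assoc[OF rH(1) vH g(1)] g(2)
        Comp_Null_left[OF rH(1) e] by simp
    then obtain o' where o: "o' \<in> Hom C Q e" "o' \<cdot> c = g \<cdot> q"
      using cokernel_factor[OF c l(1) Comp_Hom[OF qH(1) g(1)]] Q_def by metis
    have "o' \<cdot> c' = g"
    proof (rule epic_cancel[OF cokernel_epic[OF a(4)] qH(1) Comp_Hom[OF c'(1) o(1)] g(1)])
      show "(o' \<cdot> c') \<cdot> q = g \<cdot> q" using Comp_assoc[OF qH(1) c'(1) o(1)] c'(2) o(2) by simp
    qed
    then show "\<exists>w\<in>Hom C Q e. w \<cdot> c' = g" using o by blast
  qed
  moreover have "monic C v" using a(8) by (simp add: superfluous_def subobject_def)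
  ultimately have "essential (opposite C) c' D"
    using superfluous_iff_essential_cokernel[OF vH] a(8) D_def by blast
  then show ?thesis
    using op.essential_in_direct_summand_iff[of c Q M] cokernel_epic[OF c] cH qH(1) sec c'
    by auto
qed

text \<open>
  Conversely let \<open>c = c' q\<close> with \<open>q\<close> split.  The direct summand is \<open>K = ker q\<close>, and it remains
  to identify \<open>ker c'\<close> with the quotient \<open>L/K\<close>.  The section \<open>\<sigma>\<close> of \<open>q\<close> carries \<open>ker c'\<close> into
  \<open>ker c = L\<close>, so the arrow \<open>r : L \<rightarrow> ker c'\<close> induced by \<open>q\<close> is a split epimorphism, and its
  kernel is \<open>K\<close>.
\<close>

lemma lies_above_if_cokernel_essential:
  assumes l: "l \<in> Hom C L M" "monic C l" and c: "is_cokernel C l c"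
    and ess: "essential_in_direct_summand (opposite C) c M"
  shows "lies_above_direct_summand C l M"
proof -
  interpret op: abelian_category "opposite C" by (rule abelian_opposite)
  define Q where "Q = Cod C c"
  note cH = cokernelD[OF c l(1), folded Q_def]
  have lk: "is_kernel C c l" by (rule monic_kernel_of_cokernel[OF l(2) c])
  obtain D q \<sigma> c' where a: "q \<in> Hom C M D" "\<sigma> \<in> Hom C D M" "c' \<in> Hom C D Q"
      "q \<cdot> \<sigma> = Ident C D" "c' \<cdot> q = c" "essential (opposite C) c' D"
    using ess op.essential_in_direct_summand_iff[of c Q M] cH(1) by auto
  have eq: "epic C q" by (rule epic_split[OF a(2,1,4)])
  have "direct_summand (opposite C) q M"
    using op.direct_summand_if_split[of q D M \<sigma>] a by simp
  then obtain K k p p' where bi: "is_biproduct C D K M p k q p'"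
    using HomD[OF a(1)] by (auto elim: op.direct_summandE)
  have k: "k \<in> Hom C K M" "p' \<in> Hom C M K" "p' \<cdot> k = Ident C K" "q \<cdot> k = Null C K D"
    and p: "p \<in> Hom C D M" "Plus C (p \<cdot> q) (k \<cdot> p') = Ident C M"
    using bi by (auto simp: is_biproduct_def)
  have mk: "monic C k" by (rule monic_split[OF k(1,2,3)])
  have obj: "K \<in> Obj C" "M \<in> Obj C" "D \<in> Obj C" "Q \<in> Obj C" "L \<in> Obj C"
    using Hom_Obj k a l by blast+
  have kk: "is_kernel C q k"
  proof (rule is_kernelI[OF a(1) k(1) mk k(4)])
    fix e g assume g: "g \<in> Hom C e M" "q \<cdot> g = Null C e D"
    have "(p \<cdot> q) \<cdot> g = Null C e M"
      using Comp_assoc[OF g(1) a(1) p(1)] g(2) Comp_Null_right[OF p(1) Hom_Obj(1)[OF g(1)]] by simp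
    then have "k \<cdot> (p' \<cdot> g) = g"
      using Comp_Plus_left[OF g(1) Comp_Hom[OF a(1) p(1)] Comp_Hom[OF k(2,1)]] p(2)
        Comp_Ident_left[OF g(1)] Plus_Null_left[OF Comp_Hom[OF g(1) Comp_Hom[OF k(2,1)]]]
        Comp_assoc[OF g(1) k(2,1)] by simp
    then show "\<exists>u\<in>Hom C e K. k \<cdot> u = g" using Comp_Hom[OF g(1) k(2)] by blast
  qed
  have qk: "is_cokernel C k q" by (rule epic_cokernel_of_kernel[OF eq kk])
  have "c \<cdot> k = Null C K Q"
    using a(5) Comp_assoc[OF k(1) a(1,3)] k(4) Comp_Null_right[OF a(3) obj(1)] by simp
  then obtain u where u: "u \<in> Hom C K L" "l \<cdot> u = k"
    using kernel_factor[OF lk cH(1) k(1)] HomD[OF l(1)] by metis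
  obtain v where v: "is_kernel C c' v" using ex_kernel HomD[OF a(3)] by blast
  define V where "V = Dom C v"
  note vH = kernelD[OF v a(3), folded V_def]
  have mv: "monic C v" by (rule kernel_monic[OF v])
  have "c' \<cdot> (q \<cdot> l) = Null C L Q" using Comp_assoc[OF l(1) a(1,3)] a(5) cH(2) by simp
  then obtain r where r: "r \<in> Hom C L V" "v \<cdot> r = q \<cdot> l"
    using kernel_factor[OF v a(3) Comp_Hom[OF l(1) a(1)]] V_def by metis
  have sv: "\<sigma> \<cdot> v \<in> Hom C V M" by (rule Comp_Hom[OF vH(1) a(2)])
  have qsv: "q \<cdot> (\<sigma> \<cdot> v) = v"
    using Comp_assoc[OF vH(1) a(2,1)] a(4) Comp_Ident_left[OF vH(1)] by simp
  have "c \<cdot> (\<sigma> \<cdot> v) = Null C V Q"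
    using a(5) Comp_assoc[OF sv a(1,3)] qsv vH(2) by simp
  then obtain \<tau> where t: "\<tau> \<in> Hom C V L" "l \<cdot> \<tau> = \<sigma> \<cdot> v"
    using kernel_factor[OF lk cH(1) sv] HomD[OF l(1)] by metis
  have "r \<cdot> \<tau> = Ident C V"
  proof (rule monic_cancel[OF mv vH(1) Comp_Hom[OF t(1) r(1)] Ident_Hom[OF Hom_Obj(1)[OF vH(1)]]])
    show "v \<cdot> (r \<cdot> \<tau>) = v \<cdot> Ident C V"
      using Comp_assoc[OF t(1) r(1) vH(1)] r(2) Comp_assoc[OF t(1) l(1) a(1)] t(2) qsv
        Comp_Ident_right[OF vH(1)] by simp
  qed
  then have er: "epic C r" using epic_split[OF t(1) r(1)] by blast
  have "is_kernel C r u"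
  proof (rule is_kernelI[OF r(1) u(1)])
    show "monic C u" using monic_right_factor[OF u(1) l(1)] u(2) mk by simp
    show "r \<cdot> u = Null C K V"
    proof (rule monic_cancel[OF mv vH(1) Comp_Hom[OF u(1) r(1)]])
      show "Null C K V \<in> Hom C K V" using Null_Hom obj Hom_Obj(1)[OF vH(1)] by blast
      show "v \<cdot> (r \<cdot> u) = v \<cdot> Null C K V"
        using Comp_assoc[OF u(1) r(1) vH(1)] r(2) Comp_assoc[OF u(1) l(1) a(1)] u(2) k(4)
          Comp_Null_right[OF vH(1) obj(1)] by simp
    qed
    fix e g assume g: "g \<in> Hom C e L" "r \<cdot> g = Null C e V"
    have lg: "l \<cdot> g \<in> Hom C e M" by (rule Comp_Hom[OF g(1) l(1)])
    have "q \<cdot> (l \<cdot> g) = Null C e D"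
      using Comp_assoc[OF g(1) l(1) a(1)] r(2) Comp_assoc[OF g(1) r(1) vH(1)] g(2)
        Comp_Null_right[OF vH(1) Hom_Obj(1)[OF g(1)]] by simp
    then obtain o' where o: "o' \<in> Hom C e K" "k \<cdot> o' = l \<cdot> g"
      using kernel_factor[OF kk a(1) lg] HomD[OF k(1)] by metis
    have "u \<cdot> o' = g"
    proof (rule monic_cancel[OF l(2,1) Comp_Hom[OF o(1) u(1)] g(1)])
      show "l \<cdot> (u \<cdot> o') = l \<cdot> g" using Comp_assoc[OF o(1) u(1) l(1)] u(2) o(2) by simp
    qed
    then show "\<exists>w\<in>Hom C e K. u \<cdot> w = g" using o(1) by blast
  qed
  then have ur: "is_cokernel C u r" by (rule epic_cokernel_of_kernel[OF er])
  have "epic C c'" using a(6) by (simp add: essential_def subobject_def)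
  then have "is_cokernel C v c'" using epic_cokernel_of_kernel v by blast
  then have sup: "superfluous C v D"
    using superfluous_iff_essential_cokernel[OF vH(1) mv] a(6) by blast
  have ds: "direct_summand C k M" by (rule direct_summand_if_split[OF k(1,2,3)])
  have "u \<in> Hom C (Dom C k) (Dom C l)" "v \<in> Hom C (Cod C r) (Cod C q)"
    "superfluous C v (Cod C q)" "subobject C l M"
    using u(1) vH(1) sup l HomD[OF l(1)] HomD[OF k(1)] HomD[OF r(1)] HomD[OF a(1)]
    by (auto simp: subobject_def)
  then show ?thesis
    unfolding lies_above_direct_summand_def using ds u(2) qk ur r(2) by blast
qed

lemma lies_above_iff_cokernel_essential:
  assumes l: "l \<in> Hom C L M" "monic C l" and c: "is_cokernel C l c"
  shows "lies_above_direct_summand C l M \<longleftrightarrow> essential_in_direct_summand (opposite C) c M"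
  using cokernel_essential_if_lies_above[OF assms] lies_above_if_cokernel_essential[OF assms]
  by blast

text \<open>
  An image is the kernel of a cokernel, and an epimorphism is the cokernel of its kernel; so the
  cokernel of the image of \<open>f\<close> is the cokernel of \<open>f\<close>, its kernel in the opposite category.
\<close>

lemma dual_self_CS_Rickart_opposite:
  assumes "dual_self_CS_Rickart C M"
  shows "self_CS_Rickart (opposite C) M"
  unfolding self_CS_Rickart_def
proof (intro conjI ballI allI impI)
  show "M \<in> Obj (opposite C)" using assms by (simp add: dual_self_CS_Rickart_def)
  fix f k assume "f \<in> Hom (opposite C) M M" "is_kernel (opposite C) f k"
  then have f: "f \<in> Hom C M M" and k: "is_cokernel C f k" by simp_all
  note kH = cokernelD[OF k f]
  obtain m where m: "is_kernel C k m" using ex_kernel HomD[OF kH(1)] by blast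
  have "lies_above_direct_summand C m M"
    using assms f k m unfolding dual_self_CS_Rickart_def is_image_def by blast
  then show "essential_in_direct_summand (opposite C) k M"
    using lies_above_iff_cokernel_essential[OF kernelD(1)[OF m kH(1)] kernel_monic[OF m]
      epic_cokernel_of_kernel[OF cokernel_epic[OF k] m]] by blast
qed

theorem dual_self_CS_Rickart_SSP_lifting:
  assumes "dual_self_CS_Rickart C M"
  shows "SSP_lifting C M"
  unfolding SSP_lifting_def
proof (intro conjI allI impI)
  show "M \<in> Obj C" using assms by (simp add: dual_self_CS_Rickart_def)
  interpret op: abelian_category "opposite C" by (rule abelian_opposite)
  have sip: "SIP_extending (opposite C) M"
    by (rule op.self_CS_Rickart_SIP_extending[OF dual_self_CS_Rickart_opposite[OF assms]])
  fix k l s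
  assume k: "lies_above_direct_summand C k M" and l: "lies_above_direct_summand C l M"
    and s: "is_sum C k l s"
  have kl: "k \<in> Hom C (Dom C k) M" "monic C k" "l \<in> Hom C (Dom C l) M" "monic C l"
    using k l by (auto simp: lies_above_direct_summand_def subobject_def monic_def Hom_def)
  obtain c d where c: "is_cokernel C k c" and d: "is_cokernel C l d"
    using ex_cokernel HomD[OF kl(1)] HomD[OF kl(3)] by blast
  obtain i j h q where h: "is_coproduct C (Dom C k) (Dom C l) i j" "h \<in> Hom C (Cod C i) M"
      "h \<cdot> i = k" "h \<cdot> j = l" "is_cokernel C h q" "is_kernel C q s"
    using s HomD[OF kl(1)] unfolding is_sum_def is_image_def by auto
  note qH = cokernelD[OF h(5,2)]
  have "essential_in_direct_summand (opposite C) q M"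
    using sip lies_above_iff_cokernel_essential[OF kl(1,2) c] k
      lies_above_iff_cokernel_essential[OF kl(3,4) d] l
      is_intersection_opposite_cokernels_of_sum[OF kl(1,3) h(1-4) c d h(5)]
    unfolding SIP_extending_def by blast
  then show "lies_above_direct_summand C s M"
    using lies_above_iff_cokernel_essential[OF kernelD(1)[OF h(6) qH(1)] kernel_monic[OF h(6)]
      epic_cokernel_of_kernel[OF cokernel_epic[OF h(5)] h(6)]] by blast
qed

end

theorem corollary3p6:
  fixes A :: "('o, 'm) pre_additive"
  assumes "abelian_category A"
  shows "(\<forall>M\<in>Obj A. self_CS_Rickart A M \<longrightarrow> SIP_extending A M) \<and>
         (\<forall>M\<in>Obj A. dual_self_CS_Rickart A M \<longrightarrow> SSP_lifting A M)"
  using abelian_category.self_CS_Rickart_SIP_extending[OF assms]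
    abelian_category.dual_self_CS_Rickart_SSP_lifting[OF assms] by blast

end
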